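(* (Invertibility of the Hodge Laplacian.) Let $C^0,\dots,C^d$ be the graph cochain spaces of a finite clique complex, with data-driven coboundaries $\mathsf{d}_k=\mathbf{B}_{k+1}\delta_k\mathbf{B}_k^{-1}$, codifferentials $\mathsf{d}_k^*=\mathbf{D}_k^{-1}\delta_k^*\mathbf{D}_{k+1}$, and Hodge Laplacians $\Delta_k=\mathsf{d}_{k-1}\mathsf{d}_{k-1}^*+\mathsf{d}_k^*\mathsf{d}_k$, where $\mathbf{B}_k,\mathbf{D}_k$ are diagonal with positive diagonal entries. Then for every $0\le k\le d$ the operator $\Delta_k:C^k\to C^k$ is positive-semidefinite with respect to the inner product $(\mathbf{x},\mathbf{y})_k:=\mathbf{x}^{T}\mathbf{D}_k\mathbf{B}_k^{-1}\mathbf{y}$ on $C^k$, and $$\dim\ker(\Delta_k)=\dim H^k,\qquad H^k:=\ker(\mathsf{d}_k)/\operatorname{im}(\mathsf{d}_{k-1}).$$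
   Context: Fix $d\ge 1$, a finite node set, and a finite family of cliques (nonempty sets of at most $d+1$ nodes) that is closed under taking nonempty subsets (a simplicial complex). $C^k$ is the finite-dimensional real vector space of $k$-cochains: alternating real-valued functions $\phi$ on ordered $(k+1)$-cliques, $\phi_{i_{\pi(0)}\cdots i_{\pi(k)}}=\operatorname{sgn}(\pi)\,\phi_{i_0\cdots i_k}$. Fixing one orientation for each $(k+1)$-clique identifies $C^k$ with $\mathbb{R}^{N_k}$, where $N_k$ is the number of $(k+1)$-cliques; diagonal matrices and transposes are taken in these coordinates. The coboundary $\delta_k:C^k\to C^{k+1}$ is $$(\delta_k\phi)_{i_0\cdots i_{k+1}}=\sum_{j=0}^{k+1}(-1)^j\phi_{i_0\cdots\widehat{i_j}\cdots i_{k+1}},$$ which satisfies $\delta_{k+1}\circ\delta_k=0$, and $\delta_k^*:C^{k+1}\to C^k$ is its transpose. For $0\le k\le d$, $\mathbf{B}_k$ and $\mathbf{D}_k$ are arbitrary diagonal matrices with positive diagonal entries acting on $C^k$. Convention: $C^{-1}=C^{d+1}=0$, so $\mathsf{d}_{-1}$, $\mathsf{d}_{-1}^*$, $\mathsf{d}_d$, $\mathsf{d}_d^*$ are zero maps. *)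

theory Defs
  imports
    "HOL-Combinatorics.Permutations"
    "HOL-Combinatorics.List_Permutation"
    "HOL-Algebra.AbelCoset"
    "Jordan_Normal_Form.VS_Connect"
    "Jordan_Normal_Form.Gauss_Jordan_Elimination"
begin

section \<open>Clique complexes and cochains\<close>

definition clique_complex :: "'a set \<Rightarrow> nat \<Rightarrow> 'a set set \<Rightarrow> bool" where
  "clique_complex V d K \<longleftrightarrow>
     finite V \<and>
     (\<forall>\<sigma>\<in>K. \<sigma> \<noteq> {} \<and> \<sigma> \<subseteq> V \<and> card \<sigma> \<le> d + 1) \<and>
     (\<forall>\<sigma>\<in>K. \<forall>\<tau>. \<tau> \<noteq> {} \<and> \<tau> \<subseteq> \<sigma> \<longrightarrow> \<tau> \<in> K)"

text \<open>Cochains of degree \<open>k\<close> live on cliques with \<open>k + 1\<close> nodes.\<close>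

definition cliques :: "'a set set \<Rightarrow> nat \<Rightarrow> 'a set set" where
  "cliques K k = {\<sigma> \<in> K. card \<sigma> = k + 1}"

definition ordered_cliques :: "'a set set \<Rightarrow> nat \<Rightarrow> 'a list set" where
  "ordered_cliques K k = {xs. distinct xs \<and> length xs = k + 1 \<and> set xs \<in> K}"

text \<open>A function on ordered cliques is represented by its extension by zero to all lists, so that
  equality of cochains is equality of functions.\<close>

definition cochains :: "'a set set \<Rightarrow> nat \<Rightarrow> ('a list \<Rightarrow> real) set" where
  "cochains K k = {\<phi>.
     (\<forall>xs. xs \<notin> ordered_cliques K k \<longrightarrow> \<phi> xs = 0) \<and>
     (\<forall>xs\<in>ordered_cliques K k. \<forall>\<pi>. \<pi> permutes {..<k + 1} \<longrightarrow>
        \<phi> (permute_list \<pi> xs) = of_int (sign \<pi>) * \<phi> xs)}"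

text \<open>The ring fields \<open>mult\<close> and \<open>one\<close> of the record type of modules play no role for a module.\<close>

definition cochain_space :: "'a set set \<Rightarrow> nat \<Rightarrow> (real, 'a list \<Rightarrow> real) module" where
  "cochain_space K k =
     \<lparr>carrier = cochains K k, mult = undefined, one = undefined,
      zero = (\<lambda>xs. 0), add = (\<lambda>\<phi> \<psi> xs. \<phi> xs + \<psi> xs), smult = (\<lambda>c \<phi> xs. c * \<phi> xs)\<rparr>"

definition coboundary :: "'a set set \<Rightarrow> nat \<Rightarrow> ('a list \<Rightarrow> real) \<Rightarrow> 'a list \<Rightarrow> real" where
  "coboundary K k \<phi> =
     (\<lambda>xs. if xs \<in> ordered_cliques K (k + 1)
           then \<Sum>j\<le>k + 1. (- 1) ^ j * \<phi> (take j xs @ drop (Suc j) xs)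
           else 0)"

section \<open>Coordinates\<close>

text \<open>The list \<open>cl k\<close> enumerates the \<open>(k + 1)\<close>-cliques, each exactly once and with a chosen
  orientation.\<close>

definition orientation :: "'a set set \<Rightarrow> nat \<Rightarrow> (nat \<Rightarrow> 'a list list) \<Rightarrow> bool" where
  "orientation K d cl \<longleftrightarrow>
     (\<forall>k\<le>d. set (cl k) \<subseteq> ordered_cliques K k \<and>
             distinct (map set (cl k)) \<and>
             set (map set (cl k)) = cliques K k)"

definition coords ::
  "'a set set \<Rightarrow> (nat \<Rightarrow> 'a list list) \<Rightarrow> nat \<Rightarrow> ('a list \<Rightarrow> real) \<Rightarrow> real vec" where
  "coords K cl k \<phi> = vec (card (cliques K k)) (\<lambda>i. \<phi> (cl k ! i))"

definition of_coords ::
  "'a set set \<Rightarrow> (nat \<Rightarrow> 'a list list) \<Rightarrow> nat \<Rightarrow> real vec \<Rightarrow> 'a list \<Rightarrow> real" where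
  "of_coords K cl k = the_inv_into (cochains K k) (coords K cl k)"

definition matrix_of ::
  "'a set set \<Rightarrow> (nat \<Rightarrow> 'a list list) \<Rightarrow> nat \<Rightarrow> nat \<Rightarrow>
     (('a list \<Rightarrow> real) \<Rightarrow> 'a list \<Rightarrow> real) \<Rightarrow> real mat" where
  "matrix_of K cl k l T =
     mat (card (cliques K l)) (card (cliques K k))
       (\<lambda>(i, j). coords K cl l (T (of_coords K cl k (unit_vec (card (cliques K k)) j))) $ i)"

definition op_of ::
  "'a set set \<Rightarrow> (nat \<Rightarrow> 'a list list) \<Rightarrow> nat \<Rightarrow> nat \<Rightarrow> real mat \<Rightarrow>
     ('a list \<Rightarrow> real) \<Rightarrow> 'a list \<Rightarrow> real" where
  "op_of K cl k l M \<phi> = of_coords K cl l (M *\<^sub>v coords K cl k \<phi>)"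

definition coboundary_transpose ::
  "'a set set \<Rightarrow> (nat \<Rightarrow> 'a list list) \<Rightarrow> nat \<Rightarrow> ('a list \<Rightarrow> real) \<Rightarrow> 'a list \<Rightarrow> real" where
  "coboundary_transpose K cl k =
     op_of K cl (k + 1) k (transpose_mat (matrix_of K cl k (k + 1) (coboundary K k)))"

definition pos_diagonal_mat :: "nat \<Rightarrow> real mat \<Rightarrow> bool" where
  "pos_diagonal_mat n M \<longleftrightarrow>
     M \<in> carrier_mat n n \<and> diagonal_mat M \<and> (\<forall>i<n. M $$ (i, i) > 0)"

definition inverse_mat :: "real mat \<Rightarrow> real mat" where
  "inverse_mat M = the (mat_inverse M)"

section \<open>Data-driven operators\<close>

text \<open>The top degree \<open>d\<close> follows the convention that the spaces of degrees \<open>-1\<close> and \<open>d + 1\<close> are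
  zero; degree \<open>-1\<close> is handled below by the case \<open>k = 0\<close>.\<close>

definition dd_coboundary ::
  "'a set set \<Rightarrow> nat \<Rightarrow> (nat \<Rightarrow> 'a list list) \<Rightarrow> (nat \<Rightarrow> real mat) \<Rightarrow> nat \<Rightarrow>
     ('a list \<Rightarrow> real) \<Rightarrow> 'a list \<Rightarrow> real" where
  "dd_coboundary K d cl B k =
     (if k < d
      then op_of K cl (k + 1) (k + 1) (B (k + 1)) \<circ> coboundary K k
             \<circ> op_of K cl k k (inverse_mat (B k))
      else (\<lambda>\<phi> xs. 0))"

definition dd_codifferential ::
  "'a set set \<Rightarrow> nat \<Rightarrow> (nat \<Rightarrow> 'a list list) \<Rightarrow> (nat \<Rightarrow> real mat) \<Rightarrow> nat \<Rightarrow>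
     ('a list \<Rightarrow> real) \<Rightarrow> 'a list \<Rightarrow> real" where
  "dd_codifferential K d cl D k =
     (if k < d
      then op_of K cl k k (inverse_mat (D k)) \<circ> coboundary_transpose K cl k
             \<circ> op_of K cl (k + 1) (k + 1) (D (k + 1))
      else (\<lambda>\<phi> xs. 0))"

definition hodge_laplacian ::
  "'a set set \<Rightarrow> nat \<Rightarrow> (nat \<Rightarrow> 'a list list) \<Rightarrow> (nat \<Rightarrow> real mat) \<Rightarrow> (nat \<Rightarrow> real mat) \<Rightarrow> nat \<Rightarrow>
     ('a list \<Rightarrow> real) \<Rightarrow> 'a list \<Rightarrow> real" where
  "hodge_laplacian K d cl B D k \<phi> =
     (\<lambda>xs. (if k = 0 then 0
             else dd_coboundary K d cl B (k - 1) (dd_codifferential K d cl D (k - 1) \<phi>) xs)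
           + dd_codifferential K d cl D k (dd_coboundary K d cl B k \<phi>) xs)"

definition weighted_inner ::
  "'a set set \<Rightarrow> (nat \<Rightarrow> 'a list list) \<Rightarrow> (nat \<Rightarrow> real mat) \<Rightarrow> (nat \<Rightarrow> real mat) \<Rightarrow> nat \<Rightarrow>
     ('a list \<Rightarrow> real) \<Rightarrow> ('a list \<Rightarrow> real) \<Rightarrow> real" where
  "weighted_inner K cl B D k x y =
     coords K cl k x \<bullet> ((D k * inverse_mat (B k)) *\<^sub>v coords K cl k y)"

section \<open>Positive semidefinite operators, kernels, quotients\<close>

definition positive_semidefinite ::
  "(real, 'v) module \<Rightarrow> ('v \<Rightarrow> 'v \<Rightarrow> real) \<Rightarrow> ('v \<Rightarrow> 'v) \<Rightarrow> bool" where
  "positive_semidefinite V ip T \<longleftrightarrow>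
     T \<in> LinearCombinations.module_hom class_ring V V \<and>
     (\<forall>x\<in>carrier V. \<forall>y\<in>carrier V. ip (T x) y = ip x (T y)) \<and>
     (\<forall>x\<in>carrier V. 0 \<le> ip x (T x))"

definition kernel_space :: "(real, 'v) module \<Rightarrow> 'w \<Rightarrow> ('v \<Rightarrow> 'w) \<Rightarrow> (real, 'v) module" where
  "kernel_space V z T = V\<lparr>carrier := {v \<in> carrier V. T v = z}\<rparr>"

text \<open>The quotient consists of the additive cosets of \<open>W\<close>. Scalar multiplication adds \<open>W\<close> again,
  since multiplying a coset elementwise by \<open>0\<close> would give \<open>{0}\<close> instead of \<open>W\<close>.\<close>

definition quotient_space :: "(real, 'v) module \<Rightarrow> 'v set \<Rightarrow> (real, 'v set) module" where
  "quotient_space M W =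
     \<lparr>carrier = a_rcosets\<^bsub>M\<^esub> W, mult = undefined, one = undefined,
      zero = W, add = (\<lambda>S T. S <+>\<^bsub>M\<^esub> T),
      smult = (\<lambda>c S. \<Union>x\<in>S. W +>\<^bsub>M\<^esub> (c \<odot>\<^bsub>M\<^esub> x))\<rparr>"

definition coboundary_image ::
  "'a set set \<Rightarrow> nat \<Rightarrow> (nat \<Rightarrow> 'a list list) \<Rightarrow> (nat \<Rightarrow> real mat) \<Rightarrow> nat \<Rightarrow>
     ('a list \<Rightarrow> real) set" where
  "coboundary_image K d cl B k =
     (if k = 0 then {\<lambda>xs. 0} else dd_coboundary K d cl B (k - 1) ` cochains K (k - 1))"

definition cohomology ::
  "'a set set \<Rightarrow> nat \<Rightarrow> (nat \<Rightarrow> 'a list list) \<Rightarrow> (nat \<Rightarrow> real mat) \<Rightarrow> nat \<Rightarrow>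
     (real, ('a list \<Rightarrow> real) set) module" where
  "cohomology K d cl B k =
     quotient_space (kernel_space (cochain_space K k) (\<lambda>xs. 0) (dd_coboundary K d cl B k))
       (coboundary_image K d cl B k)"

end

theory Submission
  imports Defs
begin

text \<open>
  Write \<open>d\<^sub>0\<close> and \<open>d\<^sub>1\<close> for the coboundaries into and out of degree \<open>k\<close>, and \<open>a\<^sub>0\<close>, \<open>a\<^sub>1\<close> for the
  codifferentials in the opposite directions. The weights \<open>D / B\<close> are chosen so that each codifferential
  is the adjoint of the coboundary (\<open>dd_codifferential_adjoint\<close>). Hence
  \<open>(x, L y) = (a\<^sub>0 x, a\<^sub>0 y) + (d\<^sub>1 x, d\<^sub>1 y)\<close> for the Laplacian \<open>L = d\<^sub>0 a\<^sub>0 + a\<^sub>1 d\<^sub>1\<close>. This form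
  is symmetric and positive semidefinite, and it shows that \<open>L x = 0\<close> holds exactly if
  \<open>d\<^sub>1 x = 0\<close> and \<open>a\<^sub>0 x = 0\<close>, that is, if \<open>x\<close> is a cocycle orthogonal to all coboundaries; such \<open>x\<close> are called harmonic.

  Since \<open>d\<^sub>1 d\<^sub>0 = 0\<close> (\<open>dd_coboundary_dd_coboundary\<close>), orthogonal projection onto the coboundaries
  splits every cocycle into a coboundary and a harmonic cochain, and the splitting is unique because the
  inner product is definite. So the harmonic cochains map bijectively onto the cohomology
  (\<open>dim_laplacian_kernel\<close>). This argument is carried out for abstract inner product spaces.

  For cliques it remains to see that the coboundary of an alternating function is alternating
  (\<open>coboundary_cochains\<close>), and that an alternating function is the same thing as an arbitrary choice of
  values on one orientation of each clique (\<open>cochain_eqI\<close>, \<open>cochain_extension\<close>). With the latter, all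
  operators can be compared entry by entry in coordinates.
\<close>

section \<open>Orthogonal projection in real inner product spaces\<close>

text \<open>Linear independence does not depend on the ambient space, so independent subsets of \<open>W\<close> have at
  most \<open>dim\<close> elements; a largest one is a basis of \<open>W\<close>.\<close>

lemma (in vectorspace) fin_dim_subspace:
  assumes W: "VectorSpace.subspace K W V" and fd: "fin_dim"
  shows "vectorspace.fin_dim K (vs W)"
proof -
  have sub: "submodule K W V" using W by simp
  have WV: "W \<subseteq> carrier V" using sub by (simp add: submodule_def)
  interpret W: vectorspace K "vs W" by (rule subspace_is_vs[OF W])
  let ?P = "\<lambda>S. S \<subseteq> carrier (vs W) \<and> W.lin_indpt S"
  have small: "finite A \<and> card A \<le> dim" if "?P A" for A
    using that span_li_not_depend(2)[OF _ sub, of A] li_le_dim[OF fd, of A] WV by auto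
  have "?P {}" by (auto simp: W.lin_dep_def)
  then obtain A where "finite A" "maximal A ?P"
    using maximal_exists[of ?P dim "{}"] small by blast
  then have "W.basis A" by (intro W.max_li_is_basis)
  then show ?thesis
    unfolding W.fin_dim_def W.basis_def using \<open>finite A\<close> by blast
qed

locale real_inner_space = vectorspace "class_ring :: real ring" V
  for V :: "(real, 'v) module" (structure) +
  fixes ip :: "'v \<Rightarrow> 'v \<Rightarrow> real"
  assumes ip_commute: "\<lbrakk>x \<in> carrier V; y \<in> carrier V\<rbrakk> \<Longrightarrow> ip x y = ip y x"
    and ip_add_left: "\<lbrakk>x \<in> carrier V; y \<in> carrier V; z \<in> carrier V\<rbrakk>
          \<Longrightarrow> ip (x \<oplus> y) z = ip x z + ip y z"
    and ip_smult_left: "\<lbrakk>x \<in> carrier V; z \<in> carrier V\<rbrakk> \<Longrightarrow> ip (c \<odot>\<^bsub>V\<^esub> x) z = c * ip x z"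
    and ip_pos: "\<lbrakk>x \<in> carrier V; x \<noteq> \<zero>\<rbrakk> \<Longrightarrow> 0 < ip x x"
begin

lemma smult_in [simp]: "x \<in> carrier V \<Longrightarrow> c \<odot>\<^bsub>V\<^esub> x \<in> carrier V"
  by (simp add: smult_closed)

lemma minus_eq_smult: "\<lbrakk>x \<in> carrier V; y \<in> carrier V\<rbrakk> \<Longrightarrow> x \<ominus> y = x \<oplus> (-1) \<odot>\<^bsub>V\<^esub> y"
  using smult_minus_1[of y] by (simp add: a_minus_def class_ring_simps)

lemma ip_add_right: "\<lbrakk>x \<in> carrier V; y \<in> carrier V; z \<in> carrier V\<rbrakk>
    \<Longrightarrow> ip z (x \<oplus> y) = ip z x + ip z y"
  using ip_add_left ip_commute by (metis M.a_closed)

lemma ip_smult_right: "\<lbrakk>x \<in> carrier V; z \<in> carrier V\<rbrakk> \<Longrightarrow> ip z (c \<odot>\<^bsub>V\<^esub> x) = c * ip z x"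
  using ip_smult_left ip_commute by (metis smult_in)

lemma ip_minus_right: "\<lbrakk>x \<in> carrier V; y \<in> carrier V; z \<in> carrier V\<rbrakk>
    \<Longrightarrow> ip z (x \<ominus> y) = ip z x - ip z y"
  by (simp add: minus_eq_smult ip_add_right ip_smult_right)

lemma ip_zero_right [simp]: "z \<in> carrier V \<Longrightarrow> ip z \<zero> = 0"
  using ip_add_right[of \<zero> \<zero> z] by simp

lemma ip_zero_left [simp]: "z \<in> carrier V \<Longrightarrow> ip \<zero> z = 0"
  using ip_commute[of \<zero> z] by simp

lemma ip_nonneg: "x \<in> carrier V \<Longrightarrow> 0 \<le> ip x x"
  using ip_pos[of x] by (cases "x = \<zero>") auto

lemma ip_self_eq_0: "\<lbrakk>x \<in> carrier V; ip x x = 0\<rbrakk> \<Longrightarrow> x = \<zero>"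
  using ip_pos[of x] by force

text \<open>Gram--Schmidt, one generator at a time: a new generator \<open>a\<close> is replaced by its component \<open>u\<close>
  orthogonal to the span of the earlier ones, and the projection of \<open>z\<close> is corrected by a multiple
  of \<open>u\<close>. It suffices to test orthogonality on the generators, because the vectors orthogonal to the
  remainder form a submodule.\<close>

lemma orthogonal_projection_span:
  assumes "finite A" "A \<subseteq> carrier V" "z \<in> carrier V"
  shows "\<exists>w\<in>span A. \<forall>v\<in>span A. ip v (z \<ominus> w) = 0"
  using assms
proof (induction A arbitrary: z)
  case empty
  then show ?case by (auto simp: span_empty minus_eq_smult)
next
  case (insert a A)
  have A: "A \<subseteq> carrier V" "insert a A \<subseteq> carrier V" and a: "a \<in> carrier V" 
    using insert.prems by auto
  have mono: "span A \<subseteq> span (insert a A)" by (rule span_is_monotone) auto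
  have sub: "submodule class_ring (span (insert a A)) V" using span_is_submodule[OF A(2)] .
  have sub': "submodule class_ring (span A) V" using span_is_submodule[OF A(1)] .
  obtain p where p: "p \<in> span A" "\<And>v. v \<in> span A \<Longrightarrow> ip v (a \<ominus> p) = 0"
    using insert.IH[OF A(1) a] by blast
  obtain q where q: "q \<in> span A" "\<And>v. v \<in> span A \<Longrightarrow> ip v (z \<ominus> q) = 0"
    using insert.IH[OF A(1) insert.prems(2)] by blast
  have cl: "p \<in> carrier V" "q \<in> carrier V" using p q A by auto
  let ?u = "a \<ominus> p" and ?r = "z \<ominus> q"
  define c where "c = ip ?u ?r / ip ?u ?u"
  have u: "?u \<in> carrier V" using a cl by simp
  have r: "?r \<in> carrier V" using insert.prems cl by simp
  have u_span: "?u \<in> span (insert a A)"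
  proof -
    have "a \<in> span (insert a A)" using in_own_span[OF A(2)] by auto
    moreover have "(-1) \<odot>\<^bsub>V\<^esub> p \<in> span (insert a A)"
      using submodule.smult_closed[OF sub, of "-1" p] mono p by auto
    ultimately show ?thesis using submodule.m_closed[OF sub] a cl by (simp add: minus_eq_smult)
  qed
  \<comment> \<open>If \<open>a\<close> lies in the span of \<open>A\<close> then \<open>u = 0\<close>, and the division by zero in \<open>c\<close> does no harm.\<close>
  have cu: "c * ip ?u ?u = ip ?u ?r"
  proof (cases "?u = \<zero>")
    case True
    then show ?thesis using ip_commute[of \<zero> ?r] r by (simp add: c_def)
  next
    case False
    then show ?thesis using ip_pos[OF u] by (simp add: c_def)
  qed
  define w where "w = q \<oplus> c \<odot>\<^bsub>V\<^esub> ?u"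
  have w: "w \<in> span (insert a A)"
    unfolding w_def using submodule.m_closed[OF sub] submodule.smult_closed[OF sub] u_span q mono by auto
  have wc: "w \<in> carrier V" by (rule span_closed[OF A(2) w])
  have zw: "ip v (z \<ominus> w) = ip v ?r - c * ip v ?u" if "v \<in> carrier V" for v
    using that insert.prems cl u unfolding w_def
    by (simp add: ip_minus_right ip_add_right ip_smult_right)
  have orth_A: "ip v (z \<ominus> w) = 0" if "v \<in> span A" for v
    using that p q zw A by auto
  have orth_a: "ip a (z \<ominus> w) = 0"
  proof -
    have "ip a (z \<ominus> w) = ip (p \<oplus> ?u) (z \<ominus> w)"
      using a cl by (metis M.minus_eq M.a_comm M.r_neg1 M.minus_closed M.a_inv_closed M.add.m_assoc M.l_neg M.r_zero)
    also have "\<dots> = ip p (z \<ominus> w) + ip ?u (z \<ominus> w)"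
      using cl u wc insert.prems by (simp add: ip_add_left)
    also have "\<dots> = 0" using orth_A[OF p(1)] zw[OF u] cu by simp
    finally show ?thesis .
  qed
  let ?N = "{v \<in> carrier V. ip v (z \<ominus> w) = 0}"
  have zwc: "z \<ominus> w \<in> carrier V" using wc insert.prems by simp
  have "submodule class_ring ?N V"
    using zwc ip_commute[of \<zero> "z \<ominus> w"]
    by unfold_locales (auto simp: ip_add_left ip_smult_left)
  moreover have "insert a A \<subseteq> ?N" using orth_A orth_a A in_own_span[OF A(1)] by auto
  ultimately have "span (insert a A) \<subseteq> ?N" by (rule span_is_subset[rotated])
  then show ?case using w by blast
qed

lemma orthogonal_decomposition:
  assumes "fin_dim" "VectorSpace.subspace class_ring W V" "z \<in> carrier V"
  obtains w n where "w \<in> W" "n \<in> carrier V" "z = w \<oplus> n" "\<And>v. v \<in> W \<Longrightarrow> ip v n = 0"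
proof -
  have sub: "submodule class_ring W V" using assms by simp
  interpret W: vectorspace class_ring "vs W" by (rule subspace_is_vs) fact
  obtain A where A: "finite A" "A \<subseteq> W" "W.span A = W"
    using fin_dim_subspace[OF assms(2,1)] unfolding W.fin_dim_def by auto
  have WV: "W \<subseteq> carrier V" using submodule.subset[OF sub] .
  have "span A = W" using span_li_not_depend(1)[OF A(2) sub] A by simp
  then obtain w where w: "w \<in> W" "\<And>v. v \<in> W \<Longrightarrow> ip v (z \<ominus> w) = 0"
    using orthogonal_projection_span[OF A(1) _ assms(3)] A(2) WV by blast
  have "w \<in> carrier V" using w WV by blast
  moreover from this have "w \<oplus> (z \<ominus> w) = z"
    using assms(3) M.add.m_lcomm[of w z "\<ominus> w"] by (simp add: a_minus_def M.r_neg)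
  ultimately show ?thesis using that[of w "z \<ominus> w"] w assms(3) by simp
qed

end

section \<open>Quotient spaces\<close>

text \<open>A structure that is the image of a vector space under a map compatible with zero, addition and
  scaling inherits all the vector space axioms. This gives the axioms for quotients without any
  computation with cosets.\<close>

lemma vectorspace_surj_image:
  assumes V: "vectorspace K V"
    and surj: "carrier Q = f ` carrier V"
    and zero: "f \<zero>\<^bsub>V\<^esub> = \<zero>\<^bsub>Q\<^esub>"
    and add: "\<And>x y. \<lbrakk>x \<in> carrier V; y \<in> carrier V\<rbrakk> \<Longrightarrow> f (x \<oplus>\<^bsub>V\<^esub> y) = f x \<oplus>\<^bsub>Q\<^esub> f y"
    and smult: "\<And>c x. \<lbrakk>c \<in> carrier K; x \<in> carrier V\<rbrakk> \<Longrightarrow> f (c \<odot>\<^bsub>V\<^esub> x) = c \<odot>\<^bsub>Q\<^esub> f x"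
  shows "linear_map K V Q f"
proof -
  interpret V: vectorspace K V by (rule V)
  have smult_in: "f (c \<odot>\<^bsub>V\<^esub> x) \<in> f ` carrier V" if "c \<in> carrier K" "x \<in> carrier V" for c x
    using that V.smult_closed by blast
  have "vectorspace K Q"
  proof (rule vs_criteria)
    show "field K" ..
    show "\<forall>v\<in>carrier Q. \<exists>neg_v\<in>carrier Q. v \<oplus>\<^bsub>Q\<^esub> neg_v = \<zero>\<^bsub>Q\<^esub>"
    proof
      fix v assume "v \<in> carrier Q"
      then obtain x where x: "x \<in> carrier V" "v = f x" using surj by auto
      have "f x \<oplus>\<^bsub>Q\<^esub> f (\<ominus>\<^bsub>V\<^esub> x) = \<zero>\<^bsub>Q\<^esub>"
        using x add[of x "\<ominus>\<^bsub>V\<^esub> x"] by (simp add: V.M.r_neg zero)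
      then show "\<exists>neg_v\<in>carrier Q. v \<oplus>\<^bsub>Q\<^esub> neg_v = \<zero>\<^bsub>Q\<^esub>"
        using x surj by auto
    qed
    show "\<forall>v w x. v \<in> carrier Q \<and> w \<in> carrier Q \<and> x \<in> carrier Q \<longrightarrow>
        v \<oplus>\<^bsub>Q\<^esub> w \<oplus>\<^bsub>Q\<^esub> x = v \<oplus>\<^bsub>Q\<^esub> (w \<oplus>\<^bsub>Q\<^esub> x)"
      by (auto simp: surj V.M.a_assoc simp flip: add)
    show "\<forall>v w. v \<in> carrier Q \<and> w \<in> carrier Q \<longrightarrow> v \<oplus>\<^bsub>Q\<^esub> w = w \<oplus>\<^bsub>Q\<^esub> v"
      by (auto simp: surj V.M.a_comm simp flip: add)
  qed (auto simp: surj V.smult_l_distr V.smult_r_distr V.smult_assoc1 smult_in simp flip: add zero smult)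
  then interpret Q: vectorspace K Q .
  show ?thesis
    by unfold_locales (auto simp: LinearCombinations.module_hom_def surj add smult)
qed

lemma submodule_abelian_subgroup:
  fixes V :: "(real, 'v) module"
  assumes V: "vectorspace class_ring V" and W: "submodule class_ring W V"
  shows "abelian_subgroup W V"
proof -
  interpret V: vectorspace class_ring V by (rule V)
  interpret W: submodule class_ring W V by (rule W)
  have "subgroup W (add_monoid V)"
  proof (rule V.M.add.subgroupI)
    show "W \<noteq> {}" using W.zero_closed by blast
  next
    fix w assume w: "w \<in> W"
    then have "\<ominus>\<^bsub>V\<^esub> w = (-1) \<odot>\<^bsub>V\<^esub> w"
      using V.smult_minus_1[of w] W.subset by (auto simp: class_ring_simps)
    also have "\<dots> \<in> W" by (rule W.smult_closed) (use w in auto)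
    finally show "\<ominus>\<^bsub>V\<^esub> w \<in> W" .
  qed (use W.subset in auto)
  then show ?thesis
    by (intro abelian_subgroupI3 V.M.abelian_group_axioms additive_subgroup.intro)
qed

text \<open>The point is that scaling a coset in \<^const>\<open>quotient_space\<close>, which is a union over all
  representatives, gives the same coset for each of them.\<close>

lemma quotient_map_linear:
  fixes V :: "(real, 'v) module"
  assumes V: "vectorspace class_ring V" and W: "submodule class_ring W V"
  shows "linear_map class_ring V (quotient_space V W) (\<lambda>x. W +>\<^bsub>V\<^esub> x)"
proof -
  interpret V: vectorspace class_ring V by (rule V)
  interpret W: submodule class_ring W V by (rule W)
  interpret W: abelian_subgroup W V by (rule submodule_abelian_subgroup[OF V W])
  have smult: "W +>\<^bsub>V\<^esub> (c \<odot>\<^bsub>V\<^esub> x) = (\<Union>y\<in>W +>\<^bsub>V\<^esub> x. W +>\<^bsub>V\<^esub> (c \<odot>\<^bsub>V\<^esub> y))" if x: "x \<in> carrier V" for c x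
  proof -
    have "W +>\<^bsub>V\<^esub> (c \<odot>\<^bsub>V\<^esub> y) = W +>\<^bsub>V\<^esub> (c \<odot>\<^bsub>V\<^esub> x)" if y: "y \<in> W +>\<^bsub>V\<^esub> x" for y
    proof -
      obtain w where w: "w \<in> W" "y = w \<oplus>\<^bsub>V\<^esub> x" using y unfolding a_r_coset_def' by blast
      have "c \<odot>\<^bsub>V\<^esub> y = c \<odot>\<^bsub>V\<^esub> w \<oplus>\<^bsub>V\<^esub> c \<odot>\<^bsub>V\<^esub> x"
        using w x W.subset by (auto simp: V.smult_r_distr)
      then have "c \<odot>\<^bsub>V\<^esub> y \<in> W +>\<^bsub>V\<^esub> (c \<odot>\<^bsub>V\<^esub> x)"
        using w W.smult_closed[of c w] unfolding a_r_coset_def' by auto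
      then show ?thesis using x W.a_repr_independence' V.smult_closed by auto
    qed
    moreover have "x \<in> W +>\<^bsub>V\<^esub> x" by (rule W.a_rcos_self[OF x])
    ultimately show ?thesis by blast
  qed
  show ?thesis
  proof (rule vectorspace_surj_image[OF V])
    show "carrier (quotient_space V W) = (\<lambda>x. W +>\<^bsub>V\<^esub> x) ` carrier V"
      by (auto simp: quotient_space_def A_RCOSETS_def')
    show "W +>\<^bsub>V\<^esub> \<zero>\<^bsub>V\<^esub> = \<zero>\<^bsub>quotient_space V W\<^esub>"
      using W.subset by (simp add: quotient_space_def)
  qed (auto simp: quotient_space_def W.a_rcos_sum smult)
qed

lemma quotient_map_eq_zero_iff:
  fixes V :: "(real, 'v) module"
  assumes V: "vectorspace class_ring V" and W: "submodule class_ring W V" and x: "x \<in> carrier V"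
  shows "W +>\<^bsub>V\<^esub> x = \<zero>\<^bsub>quotient_space V W\<^esub> \<longleftrightarrow> x \<in> W"
proof -
  interpret W: abelian_subgroup W V by (rule submodule_abelian_subgroup[OF V W])
  show ?thesis
    using W.a_rcos_self[OF x] W.a_rcos_const[of x] by (auto simp: quotient_space_def)
qed

lemma carrier_quotient_space:
  "carrier (quotient_space V W) = (\<lambda>x. W +>\<^bsub>V\<^esub> x) ` carrier V"
  by (auto simp: quotient_space_def A_RCOSETS_def')

section \<open>Harmonic cochains and cohomology\<close>

text \<open>Three consecutive spaces of a cochain complex together with adjoints of the two maps. The
  orthogonal decompositions take place in the middle space, hence its finite dimension.\<close>

locale cochain_triple =
  U: real_inner_space U ipU + V: real_inner_space V ipV + W: real_inner_space W ipW
  for U :: "(real, 'u) module" and ipU and V :: "(real, 'v) module" and ipV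
    and W :: "(real, 'w) module" and ipW +
  fixes d\<^sub>0 :: "'u \<Rightarrow> 'v" and a\<^sub>0 :: "'v \<Rightarrow> 'u" and d\<^sub>1 :: "'v \<Rightarrow> 'w" and a\<^sub>1 :: "'w \<Rightarrow> 'v"
  assumes d0: "d\<^sub>0 \<in> LinearCombinations.module_hom class_ring U V"
    and a0: "a\<^sub>0 \<in> LinearCombinations.module_hom class_ring V U"
    and d1: "d\<^sub>1 \<in> LinearCombinations.module_hom class_ring V W"
    and a1: "a\<^sub>1 \<in> LinearCombinations.module_hom class_ring W V"
    and adjoint0: "\<lbrakk>u \<in> carrier U; v \<in> carrier V\<rbrakk> \<Longrightarrow> ipV (d\<^sub>0 u) v = ipU u (a\<^sub>0 v)"
    and adjoint1: "\<lbrakk>v \<in> carrier V; w \<in> carrier W\<rbrakk> \<Longrightarrow> ipW (d\<^sub>1 v) w = ipV v (a\<^sub>1 w)"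
    and complex: "u \<in> carrier U \<Longrightarrow> d\<^sub>1 (d\<^sub>0 u) = \<zero>\<^bsub>W\<^esub>"
    and fin_dim_V: "V.fin_dim"
begin

sublocale d0: linear_map class_ring U V d\<^sub>0 by unfold_locales (rule d0)
sublocale a0: linear_map class_ring V U a\<^sub>0 by unfold_locales (rule a0)
sublocale d1: linear_map class_ring V W d\<^sub>1 by unfold_locales (rule d1)
sublocale a1: linear_map class_ring W V a\<^sub>1 by unfold_locales (rule a1)

definition laplacian :: "'v \<Rightarrow> 'v" where
  "laplacian v = d\<^sub>0 (a\<^sub>0 v) \<oplus>\<^bsub>V\<^esub> a\<^sub>1 (d\<^sub>1 v)"

lemma laplacian_hom: "laplacian \<in> LinearCombinations.module_hom class_ring V V"
  by (auto simp: LinearCombinations.module_hom_def laplacian_def V.smult_r_distr V.M.a_ac)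

sublocale L: linear_map class_ring V V laplacian by unfold_locales (rule laplacian_hom)

lemma ip_laplacian:
  assumes "x \<in> carrier V" "y \<in> carrier V"
  shows "ipV x (laplacian y) = ipU (a\<^sub>0 x) (a\<^sub>0 y) + ipW (d\<^sub>1 x) (d\<^sub>1 y)"
proof -
  have "ipV x (d\<^sub>0 (a\<^sub>0 y)) = ipU (a\<^sub>0 x) (a\<^sub>0 y)"
    using assms adjoint0[of "a\<^sub>0 y" x] V.ip_commute[of x "d\<^sub>0 (a\<^sub>0 y)"] U.ip_commute[of "a\<^sub>0 x" "a\<^sub>0 y"] by simp
  moreover have "ipV x (a\<^sub>1 (d\<^sub>1 y)) = ipW (d\<^sub>1 x) (d\<^sub>1 y)"
    using assms adjoint1 by simp
  ultimately show ?thesis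
    using assms by (simp add: laplacian_def V.ip_add_right)
qed

text \<open>Both claims are read off from \<open>ip_laplacian\<close>, whose right-hand side is symmetric in \<open>x\<close> and
  \<open>y\<close>.\<close>

theorem laplacian_positive_semidefinite: "positive_semidefinite V ipV laplacian"
  unfolding positive_semidefinite_def
proof (intro conjI ballI laplacian_hom)
  fix x y assume xy: "x \<in> carrier V" "y \<in> carrier V"
  show "ipV (laplacian x) y = ipV x (laplacian y)"
    using xy ip_laplacian[of x y] ip_laplacian[of y x] V.ip_commute[of "laplacian x" y]
      U.ip_commute[of "a\<^sub>0 x" "a\<^sub>0 y"] W.ip_commute[of "d\<^sub>1 x" "d\<^sub>1 y"] by simp
next
  fix x assume "x \<in> carrier V"
  then show "0 \<le> ipV x (laplacian x)" by (simp add: ip_laplacian U.ip_nonneg W.ip_nonneg)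
qed

text \<open>If \<open>L x = 0\<close> then \<open>0 = (x, L x)\<close> is the sum of the squared norms of \<open>a\<^sub>0 x\<close> and \<open>d\<^sub>1 x\<close>.\<close>

lemma laplacian_kernel:
  assumes x: "x \<in> carrier V"
  shows "laplacian x = \<zero>\<^bsub>V\<^esub> \<longleftrightarrow> d\<^sub>1 x = \<zero>\<^bsub>W\<^esub> \<and> a\<^sub>0 x = \<zero>\<^bsub>U\<^esub>"
proof
  assume "laplacian x = \<zero>\<^bsub>V\<^esub>"
  then have "ipU (a\<^sub>0 x) (a\<^sub>0 x) + ipW (d\<^sub>1 x) (d\<^sub>1 x) = 0"
    using ip_laplacian[OF x x] x by simp
  then have "ipU (a\<^sub>0 x) (a\<^sub>0 x) = 0" "ipW (d\<^sub>1 x) (d\<^sub>1 x) = 0"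
    using U.ip_nonneg[of "a\<^sub>0 x"] W.ip_nonneg[of "d\<^sub>1 x"] x by auto
  then show "d\<^sub>1 x = \<zero>\<^bsub>W\<^esub> \<and> a\<^sub>0 x = \<zero>\<^bsub>U\<^esub>"
    using x by (simp add: U.ip_self_eq_0 W.ip_self_eq_0)
qed (simp add: laplacian_def)

text \<open>Hodge's theorem: each cohomology class contains exactly one harmonic cochain, so sending a harmonic
  cochain to its class is a linear bijection. A harmonic coboundary is orthogonal to itself, which gives
  injectivity. For surjectivity, split a cocycle into a coboundary and a part \<open>h\<close> orthogonal to all
  coboundaries; then \<open>h\<close> is a cocycle, and orthogonality to \<open>d\<^sub>0 (a\<^sub>0 h)\<close> forces \<open>a\<^sub>0 h = 0\<close>.\<close>

theorem dim_laplacian_kernel: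
  "vectorspace.dim class_ring (kernel_space V \<zero>\<^bsub>V\<^esub> laplacian) =
   vectorspace.dim class_ring (quotient_space (kernel_space V \<zero>\<^bsub>W\<^esub> d\<^sub>1) (d\<^sub>0 ` carrier U))"
proof -
  let ?H = "kernel_space V \<zero>\<^bsub>V\<^esub> laplacian" and ?Z = "kernel_space V \<zero>\<^bsub>W\<^esub> d\<^sub>1"
  let ?B = "d\<^sub>0 ` carrier U"
  have H: "?H = V.vs L.ker" by (simp add: kernel_space_def L.ker_def)
  have Z: "?Z = V.vs d1.ker" by (simp add: kernel_space_def d1.ker_def)
  have B: "?B = d0.im" by (simp add: d0.im_def)
  have H_iff: "x \<in> carrier ?H \<longleftrightarrow> x \<in> carrier V \<and> d\<^sub>1 x = \<zero>\<^bsub>W\<^esub> \<and> a\<^sub>0 x = \<zero>\<^bsub>U\<^esub>" for x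
    using laplacian_kernel[of x] by (auto simp: kernel_space_def)
  have H_subspace: "VectorSpace.subspace class_ring L.ker V" by (rule L.kerT_is_subspace)
  interpret H: vectorspace class_ring ?H
    unfolding H by (rule V.subspace_is_vs[OF H_subspace])
  interpret Z: vectorspace class_ring ?Z
    unfolding Z by (rule V.subspace_is_vs[OF d1.kerT_is_subspace])
  have H_fin_dim: "H.fin_dim"
    using V.fin_dim_subspace[OF H_subspace fin_dim_V] unfolding H .
  have B_subspace: "VectorSpace.subspace class_ring ?B V"
    unfolding B by (rule d0.imT_is_subspace)
  then interpret B: submodule class_ring ?B V by simp
  have BZ: "submodule class_ring ?B ?Z"
  proof
    show "?B \<subseteq> carrier ?Z" using complex by (auto simp: kernel_space_def)
  qed (auto simp: kernel_space_def intro: B.m_closed B.smult_closed B.zero_closed)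
  have q: "linear_map class_ring ?Z (quotient_space ?Z ?B) (\<lambda>x. ?B +>\<^bsub>?Z\<^esub> x)"
    by (rule quotient_map_linear[OF Z.vectorspace_axioms BZ])
  interpret Q: vectorspace class_ring "quotient_space ?Z ?B"
    by (rule linear_map.axioms(2)[OF q])
  interpret q: linear_map class_ring ?Z "quotient_space ?Z ?B" "\<lambda>x. ?B +>\<^bsub>?Z\<^esub> x"
    by (rule q)
  have HZ: "carrier ?H \<subseteq> carrier ?Z" using H_iff by (auto simp: kernel_space_def)
  have h: "linear_map class_ring ?H (quotient_space ?Z ?B) (\<lambda>x. ?B +>\<^bsub>?Z\<^esub> x)"
  proof (intro linear_map.intro mod_hom.intro mod_hom_axioms.intro)
    show "vectorspace class_ring ?H" "vectorspace class_ring (quotient_space ?Z ?B)"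
      by (rule H.vectorspace_axioms Q.vectorspace_axioms)+
    show "module class_ring ?H" "module class_ring (quotient_space ?Z ?B)"
      by (rule H.module_axioms Q.module_axioms)+
    have ops: "x \<oplus>\<^bsub>?H\<^esub> y = x \<oplus>\<^bsub>?Z\<^esub> y" "c \<odot>\<^bsub>?H\<^esub> x = c \<odot>\<^bsub>?Z\<^esub> x" for c x y
      by (simp_all add: kernel_space_def)
    show "(\<lambda>x. ?B +>\<^bsub>?Z\<^esub> x) \<in> LinearCombinations.module_hom class_ring ?H (quotient_space ?Z ?B)"
      unfolding LinearCombinations.module_hom_def ops
    proof (intro CollectI conjI allI impI Pi_I)
      fix x y assume "x \<in> carrier ?H \<and> y \<in> carrier ?H"
      then have "x \<in> carrier ?Z" "y \<in> carrier ?Z" using HZ by blast+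
      then show "?B +>\<^bsub>?Z\<^esub> (x \<oplus>\<^bsub>?Z\<^esub> y) =
          (?B +>\<^bsub>?Z\<^esub> x) \<oplus>\<^bsub>quotient_space ?Z ?B\<^esub> (?B +>\<^bsub>?Z\<^esub> y)"
        by (rule q.f_add)
    next
      fix c :: real and x assume "c \<in> carrier class_ring \<and> x \<in> carrier ?H"
      then have "c \<in> carrier class_ring" "x \<in> carrier ?Z" using HZ by blast+
      then show "?B +>\<^bsub>?Z\<^esub> (c \<odot>\<^bsub>?Z\<^esub> x) = c \<odot>\<^bsub>quotient_space ?Z ?B\<^esub> (?B +>\<^bsub>?Z\<^esub> x)"
        by (rule q.f_smult)
    next
      fix x assume "x \<in> carrier ?H"
      then show "?B +>\<^bsub>?Z\<^esub> x \<in> carrier (quotient_space ?Z ?B)"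
        using HZ by (intro q.f_im) blast
    qed
  qed
  note h_hom = linear_map.axioms(3)[OF h]
  let ?ker = "mod_hom.ker ?H (quotient_space ?Z ?B) (\<lambda>x. ?B +>\<^bsub>?Z\<^esub> x)"
  show ?thesis
  proof (rule linear_map.dim_eq[OF h H_fin_dim])
    \<comment> \<open>A harmonic coboundary \<open>x = d\<^sub>0 u\<close> satisfies \<open>(x, x) = (u, a\<^sub>0 x) = 0\<close>.\<close>
    have "x = \<zero>\<^bsub>?H\<^esub>" if "x \<in> ?ker" for x
    proof -
      have xH: "x \<in> carrier ?H" and x0: "?B +>\<^bsub>?Z\<^esub> x = \<zero>\<^bsub>quotient_space ?Z ?B\<^esub>"
        using that by (simp_all add: mod_hom.ker_def[OF h_hom])
      have x: "x \<in> carrier V" "a\<^sub>0 x = \<zero>\<^bsub>U\<^esub>" using xH H_iff by auto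
      have "x \<in> ?B" using x0 quotient_map_eq_zero_iff[OF Z.vectorspace_axioms BZ] xH HZ by blast
      then obtain u where u: "u \<in> carrier U" "x = d\<^sub>0 u" by auto
      have "ipV x x = ipU u (a\<^sub>0 x)" using adjoint0[OF u(1) x(1)] u by simp
      also have "\<dots> = 0" using u x by simp
      finally show ?thesis using x V.ip_self_eq_0 by (simp add: kernel_space_def)
    qed
    moreover have "\<zero>\<^bsub>?H\<^esub> \<in> ?ker"
      using mod_hom.f0_is_0[OF h_hom] H.M.zero_closed by (simp add: mod_hom.ker_def[OF h_hom])
    ultimately have "?ker = {\<zero>\<^bsub>?H\<^esub>}" by blast
    then show "inj_on (\<lambda>x. ?B +>\<^bsub>?Z\<^esub> x) (carrier ?H)"
      by (intro linear_map.Ke0_imp_inj[OF h]) simp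
    show "(\<lambda>x. ?B +>\<^bsub>?Z\<^esub> x) ` carrier ?H = carrier (quotient_space ?Z ?B)"
    proof
      show "(\<lambda>x. ?B +>\<^bsub>?Z\<^esub> x) ` carrier ?H \<subseteq> carrier (quotient_space ?Z ?B)"
        unfolding carrier_quotient_space by (rule image_mono[OF HZ])
      show "carrier (quotient_space ?Z ?B) \<subseteq> (\<lambda>x. ?B +>\<^bsub>?Z\<^esub> x) ` carrier ?H"
      proof
        fix S assume "S \<in> carrier (quotient_space ?Z ?B)"
        then obtain z where z: "z \<in> carrier ?Z" "S = ?B +>\<^bsub>?Z\<^esub> z"
          unfolding carrier_quotient_space by (rule imageE)
        then have zV: "z \<in> carrier V" "d\<^sub>1 z = \<zero>\<^bsub>W\<^esub>" by (simp_all add: kernel_space_def)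
        obtain b h where b: "b \<in> ?B" and hV: "h \<in> carrier V" and zbh: "z = b \<oplus>\<^bsub>V\<^esub> h"
          and orth: "\<And>v. v \<in> ?B \<Longrightarrow> ipV v h = 0"
          using V.orthogonal_decomposition[OF fin_dim_V B_subspace zV(1)] by blast
        have bV: "b \<in> carrier V" using b B.subset by blast
        have "ipU (a\<^sub>0 h) (a\<^sub>0 h) = ipV (d\<^sub>0 (a\<^sub>0 h)) h"
          by (rule adjoint0[symmetric, OF a0.f_im[OF hV] hV])
        also have "\<dots> = 0" by (rule orth[OF imageI[OF a0.f_im[OF hV]]])
        finally have a0h: "a\<^sub>0 h = \<zero>\<^bsub>U\<^esub>" by (rule U.ip_self_eq_0[OF a0.f_im[OF hV]])
        have "d\<^sub>1 b = \<zero>\<^bsub>W\<^esub>" using b complex by blast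
        then have "d\<^sub>1 h = d\<^sub>1 b \<oplus>\<^bsub>W\<^esub> d\<^sub>1 h"
          using W.M.l_zero[OF d1.f_im[OF hV]] by metis
        also have "\<dots> = d\<^sub>1 z" unfolding zbh by (rule d1.f_add[OF bV hV, symmetric])
        also have "\<dots> = \<zero>\<^bsub>W\<^esub>" by (rule zV(2))
        finally have hH: "h \<in> carrier ?H" using a0h hV by (intro iffD2[OF H_iff] conjI)
        have bZ: "b \<in> carrier ?Z" using submodule.subset[OF BZ] b by blast
        have hZ: "h \<in> carrier ?Z" using hH HZ by blast
        have "S = (?B +>\<^bsub>?Z\<^esub> b) \<oplus>\<^bsub>quotient_space ?Z ?B\<^esub> (?B +>\<^bsub>?Z\<^esub> h)"
          using q.f_add[OF bZ hZ] z(2) by (simp add: zbh kernel_space_def)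
        also have "?B +>\<^bsub>?Z\<^esub> b = \<zero>\<^bsub>quotient_space ?Z ?B\<^esub>"
          using quotient_map_eq_zero_iff[OF Z.vectorspace_axioms BZ bZ] b by blast
        also have "\<dots> \<oplus>\<^bsub>quotient_space ?Z ?B\<^esub> (?B +>\<^bsub>?Z\<^esub> h) = ?B +>\<^bsub>?Z\<^esub> h"
          by (rule Q.M.l_zero[OF q.f_im[OF hZ]])
        finally have "S = ?B +>\<^bsub>?Z\<^esub> h" .
        then show "S \<in> (\<lambda>x. ?B +>\<^bsub>?Z\<^esub> x) ` carrier ?H" using hH by (rule image_eqI)
      qed
    qed
  qed
qed

end

section \<open>The coboundary of alternating functions\<close>

definition del_nth :: "nat \<Rightarrow> 'a list \<Rightarrow> 'a list" where
  "del_nth j xs = take j xs @ drop (Suc j) xs"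

lemma length_del_nth [simp]: "j < length xs \<Longrightarrow> length (del_nth j xs) = length xs - 1"
  by (simp add: del_nth_def)

lemma coboundary_eq:
  "coboundary K k \<phi> xs =
     (if xs \<in> ordered_cliques K (k + 1) then \<Sum>j\<le>k + 1. (- 1) ^ j * \<phi> (del_nth j xs) else 0)"
  by (simp add: coboundary_def del_nth_def)

lemma nth_del_nth:
  "\<lbrakk>j < length xs; Suc i < length xs\<rbrakk> \<Longrightarrow> del_nth j xs ! i = xs ! insert_index j i"
  by (auto simp: del_nth_def nth_append insert_index_def min_def)

text \<open>\<^const>\<open>permutation_delete\<close> is the permutation that \<open>\<pi>\<close> induces on the positions other than
  \<open>j\<close>. It relates the faces of a permuted clique to the faces of the original one.\<close>

lemma del_nth_permute_list:
  assumes p: "\<pi> permutes {..<length xs}" and j: "j < length xs"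
  shows "del_nth j (permute_list \<pi> xs) = permute_list (permutation_delete \<pi> j) (del_nth (\<pi> j) xs)"
proof -
  obtain n where n: "length xs = Suc n" using j by (cases "length xs") auto
  have p': "\<pi> permutes {0..<Suc n}" using p n by (simp add: atLeast0LessThan)
  have pj: "\<pi> j < length xs" using permutes_in_image[OF p, of j] j by simp
  have q: "permutation_delete \<pi> j permutes {..<n}"
    using permutation_delete_permutes[OF p', of j] j n by (simp add: atLeast0LessThan)
  show ?thesis
  proof (rule nth_equalityI)
    fix i assume "i < length (del_nth j (permute_list \<pi> xs))"
    then have i: "i < n" using j n by simp
    have len: "length (del_nth (\<pi> j) xs) = n" using pj n by simp
    let ?m = "insert_index j i"
    have m: "?m \<noteq> j" "?m < length xs" using i n by (auto simp: insert_index_def)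
    have ne: "\<pi> ?m \<noteq> \<pi> j" using m inj_eq[OF permutes_inj[OF p]] by simp
    have "permutation_delete \<pi> j i < n" using permutes_in_image[OF q, of i] i by simp
    then have "permute_list (permutation_delete \<pi> j) (del_nth (\<pi> j) xs) ! i
        = del_nth (\<pi> j) xs ! permutation_delete \<pi> j i"
      using q len i by (intro permute_list_nth) simp_all
    also have "\<dots> = xs ! insert_index (\<pi> j) (permutation_delete \<pi> j i)"
      using \<open>permutation_delete \<pi> j i < n\<close> n pj by (intro nth_del_nth) simp_all
    also have "\<dots> = xs ! \<pi> ?m"
      using insert_delete_index[OF ne]
      by (simp add: permutation_delete_def delete_ran_def delete_dom_def)
    also have "\<dots> = permute_list \<pi> xs ! ?m"
      using m p by (simp add: permute_list_nth)
    also have "\<dots> = del_nth j (permute_list \<pi> xs) ! i"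
      using i n j by (intro nth_del_nth[symmetric]) simp_all
    finally show "del_nth j (permute_list \<pi> xs) ! i
        = permute_list (permutation_delete \<pi> j) (del_nth (\<pi> j) xs) ! i" by simp
  qed (use j pj in simp)
qed

text \<open>The sign rule of the Laplace expansion of a determinant.\<close>

lemma sign_permutation_delete:
  assumes p: "\<pi> permutes {..<Suc n}" and j: "j < Suc n"
  shows "sign (permutation_delete \<pi> j) = (-1) ^ (j + \<pi> j) * sign \<pi>"
proof -
  have p': "\<pi> permutes {0..<Suc n}" using p by (simp add: atLeast0LessThan)
  have "\<pi> j < Suc n" using permutes_in_image[OF p, of j] j by simp
  then have "sign \<pi> = (-1) ^ (j + \<pi> j) * sign (permutation_delete \<pi> j)"
    using signof_permutation_insert[where 'a = int, OF permutation_delete_permutes[OF p' j] j, of "\<pi> j"]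
      permutation_insert_delete[OF p' j] by simp
  then have "(-1) ^ (j + \<pi> j) * sign \<pi>
      = (-1) ^ (j + \<pi> j) * ((-1) ^ (j + \<pi> j) * sign (permutation_delete \<pi> j))"
    by (rule arg_cong)
  also have "\<dots> = sign (permutation_delete \<pi> j)" by (rule left_minus_one_mult_self)
  finally show ?thesis by (rule sym)
qed

lemma clique_complex_face:
  "\<lbrakk>clique_complex V d K; \<sigma> \<in> K; \<tau> \<noteq> {}; \<tau> \<subseteq> \<sigma>\<rbrakk> \<Longrightarrow> \<tau> \<in> K"
  unfolding clique_complex_def by blast

lemma del_nth_ordered_cliques:
  assumes K: "clique_complex V d K" and xs: "xs \<in> ordered_cliques K (Suc k)" and j: "j \<le> Suc k"
  shows "del_nth j xs \<in> ordered_cliques K k"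
proof -
  have len: "length (del_nth j xs) = Suc k" using xs j by (auto simp: ordered_cliques_def)
  have "set (del_nth j xs) \<subseteq> set xs" by (auto simp: del_nth_def dest: in_set_takeD in_set_dropD)
  moreover have "set (del_nth j xs) \<noteq> {}" using len by (metis list.size(3) nat.distinct(1) set_empty)
  ultimately have "set (del_nth j xs) \<in> K"
    using clique_complex_face[OF K, of "set xs"] xs by (auto simp: ordered_cliques_def)
  moreover have "distinct (del_nth j xs)"
    using xs set_take_disj_set_drop_if_distinct[of xs j "Suc j"]
    by (simp add: ordered_cliques_def del_nth_def)
  ultimately show ?thesis using len by (simp add: ordered_cliques_def)
qed

lemma permute_list_ordered_cliques:
  assumes "\<pi> permutes {..<k + 1}" "xs \<in> ordered_cliques K k"
  shows "permute_list \<pi> xs \<in> ordered_cliques K k"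
  using assms by (auto simp: ordered_cliques_def)

lemma cochainsD:
  "\<lbrakk>\<phi> \<in> cochains K k; xs \<in> ordered_cliques K k; \<pi> permutes {..<k + 1}\<rbrakk>
    \<Longrightarrow> \<phi> (permute_list \<pi> xs) = of_int (sign \<pi>) * \<phi> xs"
  by (simp add: cochains_def)

text \<open>By \<open>del_nth_permute_list\<close> and \<open>sign_permutation_delete\<close>, face \<open>j\<close> of the permuted clique contributes the sign of \<open>\<pi>\<close> times
  the contribution of face \<open>\<pi> j\<close> of the original one; summing over \<open>j\<close> permutes the faces.\<close>

lemma coboundary_cochains:
  assumes K: "clique_complex V d K" and \<phi>: "\<phi> \<in> cochains K k"
  shows "coboundary K k \<phi> \<in> cochains K (k + 1)"
  unfolding cochains_def
proof (intro CollectI conjI allI ballI impI)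
  fix xs assume "xs \<notin> ordered_cliques K (k + 1)"
  then show "coboundary K k \<phi> xs = 0" by (simp add: coboundary_eq)
next
  fix xs \<pi> assume xs: "xs \<in> ordered_cliques K (k + 1)" and p: "\<pi> permutes {..<k + 1 + 1}"
  have len: "length xs = Suc (Suc k)" using xs by (simp add: ordered_cliques_def)
  have p': "\<pi> permutes {..<Suc (Suc k)}" "\<pi> permutes {0..<Suc (Suc k)}" "\<pi> permutes {..k + 1}"
    using p by (simp_all add: atLeast0LessThan lessThan_Suc_atMost)
  have face: "(-1) ^ j * \<phi> (del_nth j (permute_list \<pi> xs))
      = of_int (sign \<pi>) * ((-1) ^ \<pi> j * \<phi> (del_nth (\<pi> j) xs))" if j: "j \<le> k + 1" for j
  proof -
    have pj: "\<pi> j \<le> k + 1" using permutes_in_image[OF p'(3), of j] j by simp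
    have q: "permutation_delete \<pi> j permutes {..<k + 1}"
      using permutation_delete_permutes[OF p'(2), of j] j by (simp add: atLeast0LessThan)
    have "\<phi> (del_nth j (permute_list \<pi> xs))
        = of_int (sign (permutation_delete \<pi> j)) * \<phi> (del_nth (\<pi> j) xs)"
      using cochainsD[OF \<phi> _ q, of "del_nth (\<pi> j) xs"] del_nth_ordered_cliques[OF K, of xs k "\<pi> j"]
        del_nth_permute_list[of \<pi> xs j] xs pj p' j len by simp
    also have "\<dots> = (-1) ^ (j + \<pi> j) * of_int (sign \<pi>) * \<phi> (del_nth (\<pi> j) xs)"
      using sign_permutation_delete[OF p'(1), of j] j by simp
    finally show ?thesis by (simp add: power_add flip: power_mult_distrib)
  qed
  have "coboundary K k \<phi> (permute_list \<pi> xs)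
      = (\<Sum>j\<le>k + 1. of_int (sign \<pi>) * ((-1) ^ \<pi> j * \<phi> (del_nth (\<pi> j) xs)))"
    using permute_list_ordered_cliques[OF p xs] face by (simp add: coboundary_eq)
  also have "\<dots> = of_int (sign \<pi>) * (\<Sum>j\<le>k + 1. (-1) ^ \<pi> j * \<phi> (del_nth (\<pi> j) xs))"
    by (rule sum_distrib_left[symmetric])
  also have "(\<Sum>j\<le>k + 1. (-1) ^ \<pi> j * \<phi> (del_nth (\<pi> j) xs)) = (\<Sum>j\<le>k + 1. (-1) ^ j * \<phi> (del_nth j xs))"
    using sum.permute[OF p'(3), of "\<lambda>j. (-1) ^ j * \<phi> (del_nth j xs)"] by (simp add: o_def)
  finally show "coboundary K k \<phi> (permute_list \<pi> xs) = of_int (sign \<pi>) * coboundary K k \<phi> xs"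
    using xs by (simp add: coboundary_eq)
qed

lemma del_nth_del_nth:
  assumes "i < j" "j < length xs"
  shows "del_nth i (del_nth j xs) = del_nth (j - 1) (del_nth i xs)"
  by (rule nth_equalityI) (use assms in \<open>auto simp: nth_del_nth insert_index_def\<close>)

text \<open>Deleting first \<open>j\<close> and then \<open>i < j\<close> leaves the same face as deleting first \<open>i\<close> and then
  \<open>j - 1\<close>, but with the opposite sign. This pairs the terms with \<open>i < j\<close> with those with
  \<open>j \<le> i\<close>.\<close>

lemma coboundary_coboundary:
  assumes K: "clique_complex V d K"
  shows "coboundary K (k + 1) (coboundary K k \<phi>) = (\<lambda>xs. 0)"
proof
  fix xs
  show "coboundary K (k + 1) (coboundary K k \<phi>) xs = 0"
  proof (cases "xs \<in> ordered_cliques K (k + 2)")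
    case False
    then show ?thesis by (simp add: coboundary_eq)
  next
    case True
    then have len: "length xs = k + 3" by (simp add: ordered_cliques_def)
    define f where "f = (\<lambda>(j, i). (-1) ^ j * (-1) ^ i * \<phi> (del_nth i (del_nth j xs)))"
    let ?P = "{..k + 2} \<times> {..k + 1}"
    let ?A = "{(j, i) \<in> ?P. i < j}" and ?B = "{(j, i) \<in> ?P. j \<le> i}"
    have fin: "finite ?A" "finite ?B" by (rule finite_subset[of _ ?P]; auto)+
    have split: "?P = ?A \<union> ?B" "?A \<inter> ?B = {}" by auto
    have "coboundary K (k + 1) (coboundary K k \<phi>) xs
        = (\<Sum>j\<le>k + 2. (-1) ^ j * (\<Sum>i\<le>k + 1. (-1) ^ i * \<phi> (del_nth i (del_nth j xs))))"
      using True del_nth_ordered_cliques[OF K, of xs "k + 1"] by (simp add: coboundary_eq)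
    also have "\<dots> = (\<Sum>j\<le>k + 2. \<Sum>i\<le>k + 1. f (j, i))"
      unfolding f_def prod.case sum_distrib_left mult.assoc ..
    also have "\<dots> = sum f ?P"
      unfolding sum.cartesian_product by (rule sum.cong) auto
    also have "\<dots> = sum f ?A + sum f ?B"
      by (subst split(1)) (rule sum.union_disjoint[OF fin split(2)])
    also have "sum f ?A = (\<Sum>p\<in>?B. - f p)"
    proof (rule sum.reindex_bij_witness[where i = "\<lambda>(j, i). (i + 1, j)" and j = "\<lambda>(j, i). (i, j - 1)"])
      fix p assume p: "p \<in> ?A"
      obtain j i where ji: "p = (j, i)" by (cases p)
      have "i < j" "j < length xs" using p len unfolding ji by simp_all
      then have swap: "del_nth i (del_nth j xs) = del_nth (j - 1) (del_nth i xs)"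
        by (rule del_nth_del_nth)
      have "(-1) ^ j = - ((-1) ^ (j - 1) :: real)"
        using \<open>i < j\<close> by (cases j) simp_all
      then show "- f (case p of (j, i) \<Rightarrow> (i, j - 1)) = f p"
        unfolding ji f_def prod.case swap by simp
    qed auto
    finally show ?thesis by (simp add: sum_negf)
  qed
qed

section \<open>Coordinates of cochains\<close>

locale oriented_complex =
  fixes V :: "'a set" and K :: "'a set set" and d :: nat and cl :: "nat \<Rightarrow> 'a list list"
  assumes complex: "clique_complex V d K" and orient: "orientation K d cl"
begin

abbreviation num_cliques :: "nat \<Rightarrow> nat" where
  "num_cliques k \<equiv> card (cliques K k)"

lemma length_cl: "k \<le> d \<Longrightarrow> length (cl k) = num_cliques k"
  using orient distinct_card[of "map set (cl k)"] by (simp add: orientation_def)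

lemma cl_nth: "\<lbrakk>k \<le> d; i < num_cliques k\<rbrakk> \<Longrightarrow> cl k ! i \<in> ordered_cliques K k"
  using orient length_cl[of k] nth_mem[of i "cl k"] unfolding orientation_def by (metis subsetD)

text \<open>Every ordered clique is a rearrangement of exactly one of the chosen representatives, by exactly one
  permutation. Hence a cochain is determined by its values on the representatives, and these values can
  be prescribed arbitrarily.\<close>

lemma ordered_clique_permutation:
  assumes k: "k \<le> d" and xs: "xs \<in> ordered_cliques K k"
  obtains i \<pi> where "i < num_cliques k" "\<pi> permutes {..<k + 1}" "xs = permute_list \<pi> (cl k ! i)"
proof -
  have "set xs \<in> cliques K k"
    using xs by (auto simp: ordered_cliques_def cliques_def distinct_card)
  also have "cliques K k = set ` set (cl k)"
    using orient k by (simp add: orientation_def)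
  finally obtain i where i: "i < length (cl k)" "set xs = set (cl k ! i)"
    by (auto simp: in_set_conv_nth)
  then have "cl k ! i \<in> ordered_cliques K k" using cl_nth length_cl k by simp
  then have len: "length (cl k ! i) = k + 1" and "mset xs = mset (cl k ! i)"
    using xs i(2) set_eq_iff_mset_eq_distinct[of xs "cl k ! i"] by (auto simp: ordered_cliques_def)
  then obtain \<pi> where "\<pi> permutes {..<k + 1}" "permute_list \<pi> (cl k ! i) = xs"
    using mset_eq_permutation[of xs "cl k ! i"] by metis
  then show ?thesis using that i length_cl[OF k] by simp
qed

lemma ordered_clique_permutation_unique:
  assumes k: "k \<le> d" and i: "i < num_cliques k" and j: "j < num_cliques k"
    and \<pi>: "\<pi> permutes {..<k + 1}" and \<rho>: "\<rho> permutes {..<k + 1}"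
    and eq: "permute_list \<pi> (cl k ! i) = permute_list \<rho> (cl k ! j)"
  shows "i = j \<and> \<pi> = \<rho>"
proof -
  have oc: "cl k ! i \<in> ordered_cliques K k" "cl k ! j \<in> ordered_cliques K k"
    using cl_nth k i j by simp_all
  then have "set (cl k ! i) = set (cl k ! j)"
    using arg_cong[OF eq, of set] \<pi> \<rho> by (simp add: ordered_cliques_def)
  moreover have "distinct (map set (cl k))" using orient k by (simp add: orientation_def)
  ultimately have ij: "i = j"
    using nth_eq_iff_index_eq[of "map set (cl k)" i j] i j length_cl[OF k] by simp
  have "\<pi> m = \<rho> m" for m
  proof (cases "m < k + 1")
    case True
    have len: "length (cl k ! i) = k + 1" and dist: "distinct (cl k ! i)"
      using oc(1) by (simp_all add: ordered_cliques_def)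
    have "\<pi> m < k + 1" "\<rho> m < k + 1"
      using permutes_in_image[OF \<pi>, of m] permutes_in_image[OF \<rho>, of m] True by simp_all
    moreover have "cl k ! i ! \<pi> m = cl k ! i ! \<rho> m"
      using arg_cong[OF eq, of "\<lambda>xs. xs ! m"] True \<pi> \<rho> len
      by (simp add: ij permute_list_nth)
    ultimately show ?thesis using nth_eq_iff_index_eq[OF dist] len by simp
  next
    case False
    then show ?thesis using permutes_not_in[OF \<pi>, of m] permutes_not_in[OF \<rho>, of m] by simp
  qed
  then show ?thesis using ij by blast
qed

lemma cochain_eqI:
  assumes k: "k \<le> d" and \<phi>: "\<phi> \<in> cochains K k" and \<psi>: "\<psi> \<in> cochains K k"
    and eq: "\<And>i. i < num_cliques k \<Longrightarrow> \<phi> (cl k ! i) = \<psi> (cl k ! i)"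
  shows "\<phi> = \<psi>"
proof
  fix xs
  show "\<phi> xs = \<psi> xs"
  proof (cases "xs \<in> ordered_cliques K k")
    case True
    then obtain i \<pi> where i: "i < num_cliques k" and \<pi>: "\<pi> permutes {..<k + 1}"
      and xs: "xs = permute_list \<pi> (cl k ! i)"
      using ordered_clique_permutation[OF k] by blast
    show ?thesis
      using cochainsD[OF \<phi> cl_nth[OF k i] \<pi>] cochainsD[OF \<psi> cl_nth[OF k i] \<pi>] eq[OF i]
      by (simp add: xs)
  next
    case False
    then show ?thesis using \<phi> \<psi> by (simp add: cochains_def)
  qed
qed

lemma cochain_extension:
  assumes k: "k \<le> d"
  obtains \<phi> where "\<phi> \<in> cochains K k" "\<And>i. i < num_cliques k \<Longrightarrow> \<phi> (cl k ! i) = v i"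
proof -
  define rep where "rep = (\<lambda>xs (i, \<pi>). i < num_cliques k \<and> \<pi> permutes {..<k + 1} \<and>
    xs = permute_list \<pi> (cl k ! i))"
  define \<phi> where "\<phi> = (\<lambda>xs. if xs \<in> ordered_cliques K k
    then case SOME p. rep xs p of (i, \<pi>) \<Rightarrow> of_int (sign \<pi>) * v i else 0)"
  have \<phi>: "\<phi> (permute_list \<pi> (cl k ! i)) = of_int (sign \<pi>) * v i"
    if i: "i < num_cliques k" and \<pi>: "\<pi> permutes {..<k + 1}" for i \<pi>
  proof -
    let ?xs = "permute_list \<pi> (cl k ! i)"
    have "rep ?xs (i, \<pi>)" using that by (simp add: rep_def)
    then have "rep ?xs (SOME p. rep ?xs p)" by (rule someI)
    moreover obtain j \<rho> where p: "(SOME p. rep ?xs p) = (j, \<rho>)" by (rule prod.exhaust)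
    ultimately have "j < num_cliques k" "\<rho> permutes {..<k + 1}" "?xs = permute_list \<rho> (cl k ! j)"
      by (simp_all add: rep_def)
    then have "i = j \<and> \<pi> = \<rho>"
      using ordered_clique_permutation_unique[OF k i _ \<pi>] by blast
    then have "(SOME p. rep ?xs p) = (i, \<pi>)" using p by simp
    then show ?thesis
      using permute_list_ordered_cliques[OF \<pi> cl_nth[OF k i]] by (simp add: \<phi>_def)
  qed
  have "\<phi> \<in> cochains K k"
    unfolding cochains_def
  proof (intro CollectI conjI allI ballI impI)
    fix xs assume "xs \<notin> ordered_cliques K k"
    then show "\<phi> xs = 0" by (simp add: \<phi>_def)
  next
    fix xs \<rho> assume "xs \<in> ordered_cliques K k" and \<rho>: "\<rho> permutes {..<k + 1}"
    then obtain i \<pi> where i: "i < num_cliques k" and \<pi>: "\<pi> permutes {..<k + 1}"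
      and xs: "xs = permute_list \<pi> (cl k ! i)"
      using ordered_clique_permutation[OF k] by blast
    have "length (cl k ! i) = k + 1" using cl_nth[OF k i] by (simp add: ordered_cliques_def)
    then have "permute_list \<rho> xs = permute_list (\<pi> \<circ> \<rho>) (cl k ! i)"
      using \<rho> by (simp add: xs permute_list_compose)
    moreover have "sign (\<pi> \<circ> \<rho>) = sign \<pi> * sign \<rho>"
      using \<pi> \<rho> by (intro sign_compose) (auto simp: permutation_permutes)
    ultimately show "\<phi> (permute_list \<rho> xs) = of_int (sign \<rho>) * \<phi> xs"
      using \<phi>[OF i permutes_compose[OF \<rho> \<pi>]] \<phi>[OF i \<pi>] by (simp add: xs)
  qed
  moreover have "\<phi> (cl k ! i) = v i" if "i < num_cliques k" for i
    using \<phi>[OF that permutes_id] by simp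
  ultimately show ?thesis using that by blast
qed

lemma dim_coords [simp]: "dim_vec (coords K cl k \<phi>) = num_cliques k"
  and coords_carrier [simp]: "coords K cl k \<phi> \<in> carrier_vec (num_cliques k)"
  and coords_nth [simp]: "i < num_cliques k \<Longrightarrow> coords K cl k \<phi> $ i = \<phi> (cl k ! i)"
  by (simp_all add: coords_def)

lemma bij_betw_coords:
  assumes k: "k \<le> d"
  shows "bij_betw (coords K cl k) (cochains K k) (carrier_vec (num_cliques k))"
  unfolding bij_betw_def
proof
  show "inj_on (coords K cl k) (cochains K k)"
  proof (rule inj_onI)
    fix \<phi> \<psi> assume "\<phi> \<in> cochains K k" "\<psi> \<in> cochains K k" "coords K cl k \<phi> = coords K cl k \<psi>"
    then show "\<phi> = \<psi>" using cochain_eqI[OF k] coords_nth by metis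
  qed
  have "v \<in> coords K cl k ` cochains K k" if v: "v \<in> carrier_vec (num_cliques k)" for v
  proof -
    obtain \<phi> where "\<phi> \<in> cochains K k" "\<And>i. i < num_cliques k \<Longrightarrow> \<phi> (cl k ! i) = v $ i"
      using cochain_extension[OF k, of "\<lambda>i. v $ i"] by blast
    then show ?thesis using v by (intro image_eqI[of _ _ \<phi>] eq_vecI) simp_all
  qed
  then show "coords K cl k ` cochains K k = carrier_vec (num_cliques k)" by auto
qed

lemma of_coords_cochain:
  "\<lbrakk>k \<le> d; v \<in> carrier_vec (num_cliques k)\<rbrakk> \<Longrightarrow> of_coords K cl k v \<in> cochains K k"
  using bij_betw_coords[of k] the_inv_into_into[of "coords K cl k" "cochains K k" v]
  by (auto simp: bij_betw_def of_coords_def)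

lemma of_coords_nth:
  "\<lbrakk>k \<le> d; v \<in> carrier_vec (num_cliques k); i < num_cliques k\<rbrakk> \<Longrightarrow> of_coords K cl k v (cl k ! i) = v $ i"
  using f_the_inv_into_f_bij_betw[OF bij_betw_coords, of k v] coords_nth[of i k "of_coords K cl k v"]
  by (simp add: of_coords_def)

lemma op_of_cochain:
  "\<lbrakk>l \<le> d; M \<in> carrier_mat (num_cliques l) (num_cliques k)\<rbrakk> \<Longrightarrow> op_of K cl k l M \<phi> \<in> cochains K l"
  by (simp add: op_of_def of_coords_cochain)

lemma op_of_nth:
  assumes "l \<le> d" "M \<in> carrier_mat (num_cliques l) (num_cliques k)" "i < num_cliques l"
  shows "op_of K cl k l M \<phi> (cl l ! i) = (\<Sum>j<num_cliques k. M $$ (i, j) * \<phi> (cl k ! j))"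
proof -
  have "op_of K cl k l M \<phi> (cl l ! i) = (M *\<^sub>v coords K cl k \<phi>) $ i"
    using assms by (simp add: op_of_def of_coords_nth)
  also have "\<dots> = (\<Sum>j<num_cliques k. M $$ (i, j) * \<phi> (cl k ! j))"
    using assms by (simp add: scalar_prod_def atLeast0LessThan)
  finally show ?thesis .
qed

text \<open>The coboundary is linear and a cochain is the combination of the dual basis cochains with its own
  values as coefficients, so the matrix of the coboundary computes it.\<close>

lemma coboundary_nth:
  assumes k: "k < d" and \<phi>: "\<phi> \<in> cochains K k" and i: "i < num_cliques (k + 1)"
  shows "coboundary K k \<phi> (cl (k + 1) ! i) =
    (\<Sum>j<num_cliques k. matrix_of K cl k (k + 1) (coboundary K k) $$ (i, j) * \<phi> (cl k ! j))"
proof -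
  have kd: "k \<le> d" using k by simp
  let ?e = "\<lambda>j. of_coords K cl k (unit_vec (num_cliques k) j)"
  have e: "?e j \<in> cochains K k" for j by (rule of_coords_cochain[OF kd unit_vec_carrier])
  have "\<phi> = (\<lambda>xs. \<Sum>j<num_cliques k. \<phi> (cl k ! j) * ?e j xs)"
  proof (rule cochain_eqI[OF kd \<phi>])
    show "(\<lambda>xs. \<Sum>j<num_cliques k. \<phi> (cl k ! j) * ?e j xs) \<in> cochains K k"
      using e by (auto simp: cochains_def sum_distrib_left mult_ac)
    fix m assume m: "m < num_cliques k"
    have "(\<Sum>j<num_cliques k. \<phi> (cl k ! j) * ?e j (cl k ! m))
        = (\<Sum>j<num_cliques k. if j = m then \<phi> (cl k ! j) else 0)"
      using m kd by (intro sum.cong) (auto simp: of_coords_nth)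
    also have "\<dots> = \<phi> (cl k ! m)" using m by simp
    finally show "\<phi> (cl k ! m) = (\<Sum>j<num_cliques k. \<phi> (cl k ! j) * ?e j (cl k ! m))" by simp
  qed
  then have "coboundary K k \<phi> (cl (k + 1) ! i)
      = coboundary K k (\<lambda>xs. \<Sum>j<num_cliques k. \<phi> (cl k ! j) * ?e j xs) (cl (k + 1) ! i)"
    by (rule arg_cong)
  also have "\<dots> = (\<Sum>j<num_cliques k. \<phi> (cl k ! j) * coboundary K k (?e j) (cl (k + 1) ! i))"
  proof (cases "cl (k + 1) ! i \<in> ordered_cliques K (k + 1)")
    case True
    let ?x = "cl (k + 1) ! i"
    have "coboundary K k (\<lambda>xs. \<Sum>j<num_cliques k. \<phi> (cl k ! j) * ?e j xs) ?x
        = (\<Sum>m\<le>k + 1. \<Sum>j<num_cliques k. (- 1) ^ m * (\<phi> (cl k ! j) * ?e j (del_nth m ?x)))"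
      using True unfolding coboundary_eq sum_distrib_left by (simp only: if_True)
    also have "\<dots> = (\<Sum>j<num_cliques k. \<Sum>m\<le>k + 1. (- 1) ^ m * (\<phi> (cl k ! j) * ?e j (del_nth m ?x)))"
      by (rule sum.swap)
    also have "\<dots> = (\<Sum>j<num_cliques k. \<phi> (cl k ! j) * coboundary K k (?e j) ?x)"
      using True by (simp only: coboundary_eq if_True sum_distrib_left mult.left_commute)
    finally show ?thesis .
  next
    case False
    then show ?thesis by (simp add: coboundary_eq)
  qed
  also have "\<dots> = (\<Sum>j<num_cliques k. matrix_of K cl k (k + 1) (coboundary K k) $$ (i, j) * \<phi> (cl k ! j))"
    using i by (intro sum.cong refl) (simp add: matrix_of_def)
  finally show ?thesis .
qed

end

section \<open>Positive diagonal matrices\<close>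

lemma pos_diagonal_mat_carrier: "pos_diagonal_mat n M \<Longrightarrow> M \<in> carrier_mat n n"
  by (simp add: pos_diagonal_mat_def)

lemma pos_diagonal_mat_sum:
  assumes "pos_diagonal_mat n M" "i < n"
  shows "(\<Sum>j<n. M $$ (i, j) * f j) = M $$ (i, i) * f i"
proof -
  have "(\<Sum>j<n. M $$ (i, j) * f j) = (\<Sum>j<n. if j = i then M $$ (i, i) * f i else 0)"
    using assms by (intro sum.cong) (auto simp: pos_diagonal_mat_def diagonal_mat_def)
  then show ?thesis using assms by simp
qed

lemma pos_diagonal_mat_mult_vec:
  assumes M: "pos_diagonal_mat n M" and v: "v \<in> carrier_vec n" and i: "i < n"
  shows "(M *\<^sub>v v) $ i = M $$ (i, i) * v $ i"
proof -
  have "(M *\<^sub>v v) $ i = (\<Sum>j<n. M $$ (i, j) * v $ j)"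
    using i v pos_diagonal_mat_carrier[OF M] by (simp add: scalar_prod_def atLeast0LessThan)
  then show ?thesis using pos_diagonal_mat_sum[OF M i, of "\<lambda>j. v $ j"] by simp
qed

text \<open>\<^const>\<open>inverse_mat\<close> comes from Gauss--Jordan elimination; it is identified by uniqueness of
  the inverse.\<close>

lemma inverse_pos_diagonal_mat:
  assumes M: "pos_diagonal_mat n M"
  shows "inverse_mat M = mat n n (\<lambda>(i, j). if i = j then 1 / M $$ (i, i) else 0)"
proof -
  let ?E = "mat n n (\<lambda>(i, j). if i = j then 1 / M $$ (i, i) else 0) :: real mat"
  have Mc: "M \<in> carrier_mat n n" and Ec: "?E \<in> carrier_mat n n"
    using M by (simp_all add: pos_diagonal_mat_carrier)
  have entry: "(\<Sum>k<n. M $$ (i, k) * ?E $$ (k, j)) = (if i = j then 1 else 0)"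
    if "i < n" "j < n" for i j
    using that M pos_diagonal_mat_sum[OF M that(1), of "\<lambda>k. ?E $$ (k, j)"]
    by (auto simp: pos_diagonal_mat_def)
  have ME: "M * ?E = 1\<^sub>m n"
  proof (rule eq_matI)
    fix i j assume "i < dim_row (1\<^sub>m n :: real mat)" "j < dim_col (1\<^sub>m n :: real mat)"
    then have ij: "i < n" "j < n" by simp_all
    have "(M * ?E) $$ (i, j) = (\<Sum>k<n. M $$ (i, k) * ?E $$ (k, j))"
      using ij Mc by (simp add: scalar_prod_def atLeast0LessThan)
    then show "(M * ?E) $$ (i, j) = 1\<^sub>m n $$ (i, j)" using entry[OF ij] ij by simp
  qed (use Mc in auto)
  have EM: "?E * M = 1\<^sub>m n"
    by (rule mat_mult_left_right_inverse[OF Mc Ec ME])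
  have "M \<in> Units (ring_mat TYPE(real) n ())"
    unfolding Units_def using Mc Ec ME EM by (auto simp: ring_mat_def)
  then obtain B where B: "mat_inverse M = Some B"
    using mat_inverse(1)[OF Mc, where b = "()"] by (cases "mat_inverse M") auto
  from mat_inverse(2)[OF Mc B] have BM: "B * M = 1\<^sub>m n" and Bc: "B \<in> carrier_mat n n" by auto
  have "B = B * (M * ?E)" using Bc by (simp add: ME)
  also have "\<dots> = ?E" using assoc_mult_mat[OF Bc Mc Ec] Ec by (simp add: BM)
  finally show ?thesis by (simp add: inverse_mat_def B)
qed

lemma pos_diagonal_inverse_mat:
  assumes "pos_diagonal_mat n M"
  shows "pos_diagonal_mat n (inverse_mat M)"
    and "i < n \<Longrightarrow> inverse_mat M $$ (i, i) = 1 / M $$ (i, i)"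
  using assms unfolding inverse_pos_diagonal_mat[OF assms]
  by (auto simp: pos_diagonal_mat_def diagonal_mat_def)

section \<open>Spaces of cochains\<close>

lemma module_hom_cochain_space:
  "f \<in> LinearCombinations.module_hom class_ring (cochain_space K k) (cochain_space K l) \<longleftrightarrow>
    (\<forall>\<phi>\<in>cochains K k. f \<phi> \<in> cochains K l) \<and>
    (\<forall>\<phi>\<in>cochains K k. \<forall>\<psi>\<in>cochains K k. f (\<lambda>xs. \<phi> xs + \<psi> xs) = (\<lambda>xs. f \<phi> xs + f \<psi> xs)) \<and>
    (\<forall>c. \<forall>\<phi>\<in>cochains K k. f (\<lambda>xs. c * \<phi> xs) = (\<lambda>xs. c * f \<phi> xs))"
  by (simp add: LinearCombinations.module_hom_def cochain_space_def Pi_iff) blast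

lemma cochains_zero: "(\<lambda>xs. 0) \<in> cochains K k"
  and cochains_add: "\<lbrakk>\<phi> \<in> cochains K k; \<psi> \<in> cochains K k\<rbrakk> \<Longrightarrow> (\<lambda>xs. \<phi> xs + \<psi> xs) \<in> cochains K k"
  and cochains_smult: "\<phi> \<in> cochains K k \<Longrightarrow> (\<lambda>xs. c * \<phi> xs) \<in> cochains K k"
  by (simp_all add: cochains_def distrib_left)

lemma cochain_space_sel [simp]:
  "carrier (cochain_space K k) = cochains K k"
  "\<zero>\<^bsub>cochain_space K k\<^esub> = (\<lambda>xs. 0)"
  "\<phi> \<oplus>\<^bsub>cochain_space K k\<^esub> \<psi> = (\<lambda>xs. \<phi> xs + \<psi> xs)"
  "c \<odot>\<^bsub>cochain_space K k\<^esub> \<phi> = (\<lambda>xs. c * \<phi> xs)"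
  by (simp_all add: cochain_space_def)

lemma vectorspace_cochain_space: "vectorspace class_ring (cochain_space K k)"
proof (rule vs_criteria)
  show "field (class_ring :: real ring)" by (rule class_field.field_axioms)
  show "\<forall>v\<in>carrier (cochain_space K k). \<exists>n\<in>carrier (cochain_space K k).
      v \<oplus>\<^bsub>cochain_space K k\<^esub> n = \<zero>\<^bsub>cochain_space K k\<^esub>"
  proof
    fix v assume "v \<in> carrier (cochain_space K k)"
    then show "\<exists>n\<in>carrier (cochain_space K k). v \<oplus>\<^bsub>cochain_space K k\<^esub> n = \<zero>\<^bsub>cochain_space K k\<^esub>"
      using cochains_smult[of v K k "-1"] by (intro bexI[of _ "\<lambda>xs. -1 * v xs"]) simp_all
  qed
qed (simp_all add: cochains_zero cochains_add cochains_smult algebra_simps)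

section \<open>The weighted complex\<close>

locale weighted_complex = oriented_complex V K d cl
  for V :: "'a set" and K d cl +
  fixes B D :: "nat \<Rightarrow> real mat"
  assumes B: "k \<le> d \<Longrightarrow> pos_diagonal_mat (num_cliques k) (B k)"
    and D: "k \<le> d \<Longrightarrow> pos_diagonal_mat (num_cliques k) (D k)"
begin

lemma B_pos: "\<lbrakk>k \<le> d; i < num_cliques k\<rbrakk> \<Longrightarrow> B k $$ (i, i) > 0"
  and D_pos: "\<lbrakk>k \<le> d; i < num_cliques k\<rbrakk> \<Longrightarrow> D k $$ (i, i) > 0"
  using B[of k] D[of k] by (simp_all add: pos_diagonal_mat_def)

text \<open>Reading coordinates backwards maps the coordinate space linearly onto the cochains.\<close>

lemma fin_dim_cochain_space:
  assumes k: "k \<le> d"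
  shows "vectorspace.fin_dim class_ring (cochain_space K k)"
proof -
  let ?n = "num_cliques k" and ?C = "cochain_space K k"
  interpret R: vec_space "TYPE(real)" ?n .
  interpret C: vectorspace class_ring ?C by (rule vectorspace_cochain_space)
  have add: "of_coords K cl k (u + v) = (\<lambda>xs. of_coords K cl k u xs + of_coords K cl k v xs)"
    if "u \<in> carrier_vec ?n" "v \<in> carrier_vec ?n" for u v
    by (rule cochain_eqI[OF k]) (use that k in \<open>auto intro!: of_coords_cochain cochains_add simp: of_coords_nth\<close>)
  have smult: "of_coords K cl k (c \<cdot>\<^sub>v v) = (\<lambda>xs. c * of_coords K cl k v xs)"
    if "v \<in> carrier_vec ?n" for c v
    by (rule cochain_eqI[OF k]) (use that k in \<open>auto intro!: of_coords_cochain cochains_smult simp: of_coords_nth\<close>)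
  have "linear_map class_ring (module_vec TYPE(real) ?n) ?C (of_coords K cl k)"
  proof (intro linear_map.intro mod_hom.intro mod_hom_axioms.intro)
    show "of_coords K cl k \<in> LinearCombinations.module_hom class_ring (module_vec TYPE(real) ?n) ?C"
      using k by (simp add: LinearCombinations.module_hom_def module_vec_simps of_coords_cochain add smult)
  qed (rule R.vectorspace_axioms R.module_axioms C.vectorspace_axioms C.module_axioms)+
  moreover have "of_coords K cl k ` carrier (module_vec TYPE(real) ?n) = carrier ?C"
    using bij_betw_imp_surj_on[OF bij_betw_the_inv_into[OF bij_betw_coords[OF k]]]
    by (simp add: of_coords_def module_vec_simps)
  ultimately show ?thesis by (rule linear_map.surj_fin_dim[OF _ R.fin_dim])
qed

lemma op_of_diagonal_nth:
  assumes "k \<le> d" "pos_diagonal_mat (num_cliques k) M" "i < num_cliques k"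
  shows "op_of K cl k k M \<phi> (cl k ! i) = M $$ (i, i) * \<phi> (cl k ! i)"
  using assms by (simp add: op_of_nth pos_diagonal_mat_carrier pos_diagonal_mat_sum)

lemma op_of_diagonal_cochain:
  "\<lbrakk>k \<le> d; pos_diagonal_mat (num_cliques k) M\<rbrakk> \<Longrightarrow> op_of K cl k k M \<phi> \<in> cochains K k"
  by (simp add: op_of_cochain pos_diagonal_mat_carrier)

lemma weighted_inner_sum:
  assumes k: "k \<le> d"
  shows "weighted_inner K cl B D k \<phi> \<psi> =
    (\<Sum>i<num_cliques k. D k $$ (i, i) / B k $$ (i, i) * (\<phi> (cl k ! i) * \<psi> (cl k ! i)))"
proof -
  let ?n = "num_cliques k" and ?I = "inverse_mat (B k)"
  have c: "D k \<in> carrier_mat ?n ?n" "?I \<in> carrier_mat ?n ?n"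
    using D[OF k] pos_diagonal_inverse_mat(1)[OF B[OF k]] by (simp_all add: pos_diagonal_mat_carrier)
  have "((D k * ?I) *\<^sub>v coords K cl k \<psi>) $ i = D k $$ (i, i) / B k $$ (i, i) * \<psi> (cl k ! i)"
    if i: "i < ?n" for i
  proof -
    have "((D k * ?I) *\<^sub>v coords K cl k \<psi>) $ i = (D k *\<^sub>v (?I *\<^sub>v coords K cl k \<psi>)) $ i"
      using assoc_mult_mat_vec[OF c coords_carrier, of \<psi>] by simp
    also have "\<dots> = D k $$ (i, i) * (?I *\<^sub>v coords K cl k \<psi>) $ i"
      by (rule pos_diagonal_mat_mult_vec[OF D[OF k] mult_mat_vec_carrier[OF c(2) coords_carrier] i])
    also have "(?I *\<^sub>v coords K cl k \<psi>) $ i = ?I $$ (i, i) * coords K cl k \<psi> $ i"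
      by (rule pos_diagonal_mat_mult_vec[OF pos_diagonal_inverse_mat(1)[OF B[OF k]] coords_carrier i])
    finally show ?thesis using i by (simp add: pos_diagonal_inverse_mat(2)[OF B[OF k]])
  qed
  moreover have "dim_vec ((D k * ?I) *\<^sub>v coords K cl k \<psi>) = ?n" using c by simp
  ultimately show ?thesis
    by (simp add: weighted_inner_def scalar_prod_def atLeast0LessThan mult_ac del: index_mult_mat_vec)
qed

lemma real_inner_space_cochains:
  assumes k: "k \<le> d"
  shows "real_inner_space (cochain_space K k) (weighted_inner K cl B D k)"
proof (intro real_inner_space.intro real_inner_space_axioms.intro vectorspace_cochain_space)
  let ?ip = "weighted_inner K cl B D k"
  note ip = weighted_inner_sum[OF k]
  fix \<phi> \<psi> \<chi> and c :: real
  show "?ip \<phi> \<psi> = ?ip \<psi> \<phi>" by (simp add: ip mult_ac)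
  show "?ip (\<phi> \<oplus>\<^bsub>cochain_space K k\<^esub> \<psi>) \<chi> = ?ip \<phi> \<chi> + ?ip \<psi> \<chi>"
    by (simp add: ip algebra_simps sum.distrib)
  show "?ip (c \<odot>\<^bsub>cochain_space K k\<^esub> \<phi>) \<chi> = c * ?ip \<phi> \<chi>"
    by (simp add: ip sum_distrib_left mult_ac)
  assume "\<phi> \<in> carrier (cochain_space K k)" and "\<phi> \<noteq> \<zero>\<^bsub>cochain_space K k\<^esub>"
  then have "\<phi> \<in> cochains K k" "\<phi> \<noteq> (\<lambda>xs. 0)" by simp_all
  then obtain i where i: "i < num_cliques k" "\<phi> (cl k ! i) \<noteq> 0"
    using cochain_eqI[OF k _ cochains_zero] by blast
  have "0 < (\<Sum>i<num_cliques k. D k $$ (i, i) / B k $$ (i, i) * (\<phi> (cl k ! i) * \<phi> (cl k ! i)))"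
  proof (rule sum_pos2)
    show "0 < D k $$ (i, i) / B k $$ (i, i) * (\<phi> (cl k ! i) * \<phi> (cl k ! i))"
    proof -
      have "0 < \<phi> (cl k ! i) * \<phi> (cl k ! i)" using i(2) not_real_square_gt_zero by blast
      then show ?thesis using B_pos[OF k i(1)] D_pos[OF k i(1)] by (simp only: mult_pos_pos divide_pos_pos)
    qed
    show "0 \<le> D k $$ (j, j) / B k $$ (j, j) * (\<phi> (cl k ! j) * \<phi> (cl k ! j))"
      if "j \<in> {..<num_cliques k}" for j
      using that less_imp_le[OF B_pos[OF k]] less_imp_le[OF D_pos[OF k]] by simp
  qed (use i in simp_all)
  then show "0 < ?ip \<phi> \<phi>" by (simp add: ip)
qed

abbreviation incidence :: "nat \<Rightarrow> real mat" where
  "incidence k \<equiv> matrix_of K cl k (k + 1) (coboundary K k)"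

lemma incidence_carrier: "incidence k \<in> carrier_mat (num_cliques (k + 1)) (num_cliques k)"
  by (simp add: matrix_of_def)

lemma dd_coboundary_cochain:
  assumes "k < d"
  shows "dd_coboundary K d cl B k \<phi> \<in> cochains K (k + 1)"
  using assms B[of "k + 1"] by (simp add: dd_coboundary_def op_of_diagonal_cochain)

lemma dd_coboundary_nth:
  assumes k: "k < d" and i: "i < num_cliques (k + 1)"
  shows "dd_coboundary K d cl B k \<phi> (cl (k + 1) ! i) = B (k + 1) $$ (i, i) *
    (\<Sum>j<num_cliques k. incidence k $$ (i, j) * (\<phi> (cl k ! j) / B k $$ (j, j)))"
proof -
  have k': "k \<le> d" "k + 1 \<le> d" using k by simp_all
  note I = pos_diagonal_inverse_mat[OF B[OF k'(1)]]
  let ?\<psi> = "op_of K cl k k (inverse_mat (B k)) \<phi>"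
  have "dd_coboundary K d cl B k \<phi> (cl (k + 1) ! i)
      = B (k + 1) $$ (i, i) * coboundary K k ?\<psi> (cl (k + 1) ! i)"
    using k by (simp only: dd_coboundary_def if_True o_apply op_of_diagonal_nth[OF k'(2) B[OF k'(2)] i])
  also have "coboundary K k ?\<psi> (cl (k + 1) ! i) = (\<Sum>j<num_cliques k. incidence k $$ (i, j) * ?\<psi> (cl k ! j))"
    by (rule coboundary_nth[OF k op_of_diagonal_cochain[OF k'(1) I(1)] i])
  also have "\<dots> = (\<Sum>j<num_cliques k. incidence k $$ (i, j) * (\<phi> (cl k ! j) / B k $$ (j, j)))"
    by (intro sum.cong refl) (simp add: op_of_diagonal_nth[OF k'(1) I(1)] I(2))
  finally show ?thesis .
qed

lemma dd_codifferential_cochain: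
  assumes "k < d"
  shows "dd_codifferential K d cl D k \<psi> \<in> cochains K k"
  using assms pos_diagonal_inverse_mat(1)[OF D[of k]]
  by (simp add: dd_codifferential_def op_of_diagonal_cochain)

lemma dd_codifferential_nth:
  assumes k: "k < d" and j: "j < num_cliques k"
  shows "dd_codifferential K d cl D k \<psi> (cl k ! j) =
    (\<Sum>i<num_cliques (k + 1). incidence k $$ (i, j) * (D (k + 1) $$ (i, i) * \<psi> (cl (k + 1) ! i)))
      / D k $$ (j, j)"
proof -
  have k': "k \<le> d" "k + 1 \<le> d" using k by simp_all
  note I = pos_diagonal_inverse_mat[OF D[OF k'(1)]]
  let ?\<phi> = "op_of K cl (k + 1) (k + 1) (D (k + 1)) \<psi>"
  have "dd_codifferential K d cl D k \<psi> (cl k ! j)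
      = inverse_mat (D k) $$ (j, j) * coboundary_transpose K cl k ?\<phi> (cl k ! j)"
    using k by (simp only: dd_codifferential_def if_True o_apply op_of_diagonal_nth[OF k'(1) I(1) j])
  also have "inverse_mat (D k) $$ (j, j) = 1 / D k $$ (j, j)" by (rule I(2)[OF j])
  also have "coboundary_transpose K cl k ?\<phi> (cl k ! j)
      = (\<Sum>i<num_cliques (k + 1). transpose_mat (incidence k) $$ (j, i) * ?\<phi> (cl (k + 1) ! i))"
    unfolding coboundary_transpose_def
    by (rule op_of_nth[OF k'(1) _ j]) (use incidence_carrier in simp)
  also have "\<dots> = (\<Sum>i<num_cliques (k + 1). incidence k $$ (i, j) * (D (k + 1) $$ (i, i) * \<psi> (cl (k + 1) ! i)))"
    using j incidence_carrier[of k]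
    by (intro sum.cong refl) (simp add: op_of_diagonal_nth[OF k'(2) D[OF k'(2)], simplified])
  finally show ?thesis by simp
qed

lemma dd_coboundary_hom:
  assumes k: "k < d"
  shows "dd_coboundary K d cl B k \<in>
    LinearCombinations.module_hom class_ring (cochain_space K k) (cochain_space K (k + 1))"
proof -
  have k': "k + 1 \<le> d" using k by simp
  show ?thesis
    unfolding module_hom_cochain_space
  proof (intro conjI ballI allI)
    fix \<phi> \<psi> assume "\<phi> \<in> cochains K k" "\<psi> \<in> cochains K k"
    show "dd_coboundary K d cl B k (\<lambda>xs. \<phi> xs + \<psi> xs)
        = (\<lambda>xs. dd_coboundary K d cl B k \<phi> xs + dd_coboundary K d cl B k \<psi> xs)"
      by (rule cochain_eqI[OF k'])
        (simp_all only: cochains_add dd_coboundary_cochain[OF k] dd_coboundary_nth[OF k]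
          add_divide_distrib distrib_left sum.distrib)
  next
    fix c \<phi> assume "\<phi> \<in> cochains K k"
    show "dd_coboundary K d cl B k (\<lambda>xs. c * \<phi> xs) = (\<lambda>xs. c * dd_coboundary K d cl B k \<phi> xs)"
      by (rule cochain_eqI[OF k'])
        (simp_all only: cochains_smult dd_coboundary_cochain[OF k] dd_coboundary_nth[OF k]
          times_divide_eq_right[symmetric] sum_distrib_left mult.left_commute)
  qed (rule dd_coboundary_cochain[OF k])
qed

lemma dd_codifferential_hom:
  assumes k: "k < d"
  shows "dd_codifferential K d cl D k \<in>
    LinearCombinations.module_hom class_ring (cochain_space K (k + 1)) (cochain_space K k)"
proof -
  have k': "k \<le> d" using k by simp
  show ?thesis
    unfolding module_hom_cochain_space
  proof (intro conjI ballI allI)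
    fix \<phi> \<psi> assume "\<phi> \<in> cochains K (k + 1)" "\<psi> \<in> cochains K (k + 1)"
    show "dd_codifferential K d cl D k (\<lambda>xs. \<phi> xs + \<psi> xs)
        = (\<lambda>xs. dd_codifferential K d cl D k \<phi> xs + dd_codifferential K d cl D k \<psi> xs)"
      by (rule cochain_eqI[OF k'])
        (simp_all only: cochains_add dd_codifferential_cochain[OF k] dd_codifferential_nth[OF k]
          add_divide_distrib distrib_left sum.distrib)
  next
    fix c \<phi> assume "\<phi> \<in> cochains K (k + 1)"
    show "dd_codifferential K d cl D k (\<lambda>xs. c * \<phi> xs) = (\<lambda>xs. c * dd_codifferential K d cl D k \<phi> xs)"
      by (rule cochain_eqI[OF k'])
        (simp_all only: cochains_smult dd_codifferential_cochain[OF k] dd_codifferential_nth[OF k]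
          times_divide_eq_right sum_distrib_left mult.left_commute)
  qed (rule dd_codifferential_cochain[OF k])
qed

text \<open>With the weights \<open>D / B\<close> both sides are the same double sum, with the terms
  \<open>M i j * (\<phi> j / B j) * (D i * \<psi> i)\<close> where \<open>M\<close> is the incidence matrix: on the left the
  weight of degree \<open>k + 1\<close> cancels the factor \<open>B (k + 1)\<close> of the coboundary, on the right the
  weight of degree \<open>k\<close> cancels the factor \<open>1 / D k\<close> of the codifferential.\<close>

lemma dd_codifferential_adjoint:
  assumes k: "k < d"
  shows "weighted_inner K cl B D (k + 1) (dd_coboundary K d cl B k \<phi>) \<psi>
    = weighted_inner K cl B D k \<phi> (dd_codifferential K d cl D k \<psi>)"
proof -
  have k': "k \<le> d" "k + 1 \<le> d" using k by simp_all
  let ?t = "\<lambda>i j. incidence k $$ (i, j) * (\<phi> (cl k ! j) / B k $$ (j, j)) *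
    (D (k + 1) $$ (i, i) * \<psi> (cl (k + 1) ! i))"
  have "weighted_inner K cl B D (k + 1) (dd_coboundary K d cl B k \<phi>) \<psi>
      = (\<Sum>i<num_cliques (k + 1). \<Sum>j<num_cliques k. ?t i j)"
    unfolding weighted_inner_sum[OF k'(2)]
  proof (intro sum.cong refl)
    fix i assume "i \<in> {..<num_cliques (k + 1)}"
    then have i: "i < num_cliques (k + 1)" by simp
    let ?S = "\<Sum>j<num_cliques k. incidence k $$ (i, j) * (\<phi> (cl k ! j) / B k $$ (j, j))"
    have "D (k + 1) $$ (i, i) / B (k + 1) $$ (i, i) *
        (dd_coboundary K d cl B k \<phi> (cl (k + 1) ! i) * \<psi> (cl (k + 1) ! i))
        = ?S * (D (k + 1) $$ (i, i) * \<psi> (cl (k + 1) ! i))"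
      unfolding dd_coboundary_nth[OF k i] using B_pos[OF k'(2) i] by simp
    also have "\<dots> = (\<Sum>j<num_cliques k. ?t i j)" by (rule sum_distrib_right)
    finally show "D (k + 1) $$ (i, i) / B (k + 1) $$ (i, i) *
        (dd_coboundary K d cl B k \<phi> (cl (k + 1) ! i) * \<psi> (cl (k + 1) ! i))
        = (\<Sum>j<num_cliques k. ?t i j)" .
  qed
  also have "\<dots> = (\<Sum>j<num_cliques k. \<Sum>i<num_cliques (k + 1). ?t i j)" by (rule sum.swap)
  also have "\<dots> = weighted_inner K cl B D k \<phi> (dd_codifferential K d cl D k \<psi>)"
    unfolding weighted_inner_sum[OF k'(1)]
  proof (intro sum.cong refl)
    fix j assume "j \<in> {..<num_cliques k}"
    then have j: "j < num_cliques k" by simp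
    let ?S = "\<Sum>i<num_cliques (k + 1). incidence k $$ (i, j) * (D (k + 1) $$ (i, i) * \<psi> (cl (k + 1) ! i))"
    have "(\<Sum>i<num_cliques (k + 1). ?t i j) = \<phi> (cl k ! j) / B k $$ (j, j) * ?S"
      unfolding sum_distrib_left by (intro sum.cong refl) (simp only: mult_ac)
    also have "\<dots> = D k $$ (j, j) / B k $$ (j, j) *
        (\<phi> (cl k ! j) * dd_codifferential K d cl D k \<psi> (cl k ! j))"
      unfolding dd_codifferential_nth[OF k j] using D_pos[OF k'(1) j] by simp
    finally show "(\<Sum>i<num_cliques (k + 1). ?t i j) = D k $$ (j, j) / B k $$ (j, j) *
        (\<phi> (cl k ! j) * dd_codifferential K d cl D k \<psi> (cl k ! j))" .
  qed
  finally show ?thesis .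
qed

text \<open>Between the two coboundaries the matrix \<open>B (k + 1)\<close> meets its inverse, which leaves the square
  of the plain coboundary.\<close>

lemma dd_coboundary_dd_coboundary:
  assumes k: "k + 1 < d"
  shows "dd_coboundary K d cl B (k + 1) (dd_coboundary K d cl B k \<phi>) = (\<lambda>xs. 0)"
proof -
  have k': "k \<le> d" "k + 1 \<le> d" "k + 2 \<le> d" using k by simp_all
  let ?\<psi> = "coboundary K k (op_of K cl k k (inverse_mat (B k)) \<phi>)"
  note I = pos_diagonal_inverse_mat[OF B[OF k'(2)]]
  have \<psi>: "?\<psi> \<in> cochains K (k + 1)"
    by (intro coboundary_cochains[OF complex] op_of_diagonal_cochain k'(1)
        pos_diagonal_inverse_mat(1)[OF B[OF k'(1)]])
  have "op_of K cl (k + 1) (k + 1) (inverse_mat (B (k + 1))) (op_of K cl (k + 1) (k + 1) (B (k + 1)) ?\<psi>) = ?\<psi>"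
  proof (rule cochain_eqI[OF k'(2) op_of_diagonal_cochain[OF k'(2) I(1)] \<psi>])
    fix i assume i: "i < num_cliques (k + 1)"
    show "op_of K cl (k + 1) (k + 1) (inverse_mat (B (k + 1))) (op_of K cl (k + 1) (k + 1) (B (k + 1)) ?\<psi>) (cl (k + 1) ! i)
        = ?\<psi> (cl (k + 1) ! i)"
      unfolding op_of_diagonal_nth[OF k'(2) I(1) i] op_of_diagonal_nth[OF k'(2) B[OF k'(2)] i] I(2)[OF i]
      using B_pos[OF k'(2) i] by simp
  qed
  then have "dd_coboundary K d cl B (k + 1) (dd_coboundary K d cl B k \<phi>)
      = op_of K cl (k + 2) (k + 2) (B (k + 2)) (\<lambda>xs. 0)"
    using k coboundary_coboundary[OF complex, of k "op_of K cl k k (inverse_mat (B k)) \<phi>"]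
    by (simp add: dd_coboundary_def)
  also have "\<dots> = (\<lambda>xs. 0)"
    by (rule cochain_eqI[OF k'(3) op_of_diagonal_cochain[OF k'(3) B[OF k'(3)]] cochains_zero])
      (simp only: op_of_diagonal_nth[OF k'(3) B[OF k'(3)]] mult_zero_right)
  finally show ?thesis .
qed

lemma zero_hom: "(\<lambda>\<phi> xs. 0) \<in> LinearCombinations.module_hom class_ring (cochain_space K k) (cochain_space K l)"
  unfolding module_hom_cochain_space by (simp add: cochains_zero)

text \<open>At the ends of the complex the missing neighbour is represented by the space of degree \<open>k\<close> itself
  with zero maps, since it comes with an inner product and zero maps have the same kernel, image and
  Laplacian whatever space they involve. For \<open>k = 0\<close> truncated subtraction makes \<open>k - 1\<close> the degree of this space.\<close>

lemma cochain_triple_dd: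
  assumes k: "k \<le> d"
  defines "u \<equiv> k - 1" and "w \<equiv> if k < d then k + 1 else k"
  shows "cochain_triple (cochain_space K u) (weighted_inner K cl B D u)
    (cochain_space K k) (weighted_inner K cl B D k)
    (cochain_space K w) (weighted_inner K cl B D w)
    (if k = 0 then \<lambda>\<phi> xs. 0 else dd_coboundary K d cl B (k - 1))
    (if k = 0 then \<lambda>\<phi> xs. 0 else dd_codifferential K d cl D (k - 1))
    (dd_coboundary K d cl B k) (dd_codifferential K d cl D k)"
proof -
  have uw: "u \<le> d" "w \<le> d" using k by (simp_all add: u_def w_def)
  interpret U: real_inner_space "cochain_space K u" "weighted_inner K cl B D u"
    by (rule real_inner_space_cochains[OF uw(1)])
  interpret C: real_inner_space "cochain_space K k" "weighted_inner K cl B D k"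
    by (rule real_inner_space_cochains[OF k])
  interpret W: real_inner_space "cochain_space K w" "weighted_inner K cl B D w"
    by (rule real_inner_space_cochains[OF uw(2)])
  have zero: "weighted_inner K cl B D l (\<lambda>xs. 0) \<phi> = 0" "weighted_inner K cl B D l \<phi> (\<lambda>xs. 0) = 0"
    if "l \<le> d" for l \<phi> by (simp_all add: weighted_inner_sum[OF that])
  have top: "dd_coboundary K d cl B k = (\<lambda>\<phi> xs. 0)" "dd_codifferential K d cl D k = (\<lambda>\<phi> xs. 0)"
    if "\<not> k < d" using that by (simp_all add: dd_coboundary_def dd_codifferential_def)
  have low: "k - 1 < d" "k - 1 + 1 = k" if "k \<noteq> 0" using that k by simp_all
  show ?thesis
  proof (intro cochain_triple.intro cochain_triple_axioms.intro
      U.real_inner_space_axioms C.real_inner_space_axioms W.real_inner_space_axioms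
      fin_dim_cochain_space k)
    show "(if k = 0 then \<lambda>\<phi> xs. 0 else dd_coboundary K d cl B (k - 1)) \<in>
        LinearCombinations.module_hom class_ring (cochain_space K u) (cochain_space K k)"
      using zero_hom[of u k] dd_coboundary_hom[OF low(1)] low(2) by (auto simp: u_def)
    show "(if k = 0 then \<lambda>\<phi> xs. 0 else dd_codifferential K d cl D (k - 1)) \<in>
        LinearCombinations.module_hom class_ring (cochain_space K k) (cochain_space K u)"
      using zero_hom[of k u] dd_codifferential_hom[OF low(1)] low(2) by (auto simp: u_def)
    show "dd_coboundary K d cl B k \<in>
        LinearCombinations.module_hom class_ring (cochain_space K k) (cochain_space K w)"
      using zero_hom[of k w] dd_coboundary_hom[of k] top(1) by (cases "k < d") (simp_all add: w_def)
    show "dd_codifferential K d cl D k \<in>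
        LinearCombinations.module_hom class_ring (cochain_space K w) (cochain_space K k)"
      using zero_hom[of w k] dd_codifferential_hom[of k] top(2) by (cases "k < d") (simp_all add: w_def)
  next
    fix \<phi> \<psi>
    show "weighted_inner K cl B D k ((if k = 0 then \<lambda>\<phi> xs. 0 else dd_coboundary K d cl B (k - 1)) \<phi>) \<psi>
        = weighted_inner K cl B D u \<phi> ((if k = 0 then \<lambda>\<phi> xs. 0 else dd_codifferential K d cl D (k - 1)) \<psi>)"
      using zero k uw(1) dd_codifferential_adjoint[OF low(1), of \<phi> \<psi>] low(2) by (auto simp: u_def)
  next
    fix \<phi> \<psi>
    show "weighted_inner K cl B D w (dd_coboundary K d cl B k \<phi>) \<psi>
        = weighted_inner K cl B D k \<phi> (dd_codifferential K d cl D k \<psi>)"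
      using zero k uw(2) dd_codifferential_adjoint[of k \<phi> \<psi>] top by (cases "k < d") (simp_all add: w_def)
  next
    fix \<phi> assume "\<phi> \<in> carrier (cochain_space K u)"
    show "dd_coboundary K d cl B k ((if k = 0 then \<lambda>\<phi> xs. 0 else dd_coboundary K d cl B (k - 1)) \<phi>)
        = \<zero>\<^bsub>cochain_space K w\<^esub>"
    proof (cases "k < d")
      case True
      have "dd_coboundary K d cl B k (\<lambda>xs. 0) = (\<lambda>xs. 0)"
        using dd_coboundary_nth[OF True] cochain_eqI[OF _ dd_coboundary_cochain[OF True] cochains_zero] True
        by simp
      then show ?thesis
        using dd_coboundary_dd_coboundary[of "k - 1" \<phi>] low(2) True by auto
    qed (simp add: top)
  qed
qed

end

theorem theorem3p5:
  fixes V :: "'a set" and K :: "'a set set" and d k :: nat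
    and cl :: "nat \<Rightarrow> 'a list list"
    and B D :: "nat \<Rightarrow> real mat"
  assumes "d \<ge> 1"
    and "clique_complex V d K"
    and "orientation K d cl"
    and "\<And>j. j \<le> d \<Longrightarrow> pos_diagonal_mat (card (cliques K j)) (B j)"
    and "\<And>j. j \<le> d \<Longrightarrow> pos_diagonal_mat (card (cliques K j)) (D j)"
    and "k \<le> d"
  shows "positive_semidefinite (cochain_space K k) (weighted_inner K cl B D k)
           (hodge_laplacian K d cl B D k) \<and>
         vectorspace.dim class_ring
           (kernel_space (cochain_space K k) (\<lambda>xs. 0) (hodge_laplacian K d cl B D k))
         = vectorspace.dim class_ring (cohomology K d cl B k)"
proof -
  interpret weighted_complex V K d cl B D
    using assms by unfold_locales
  define w where "w = (if k < d then k + 1 else k)"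
  interpret T: cochain_triple "cochain_space K (k - 1)" "weighted_inner K cl B D (k - 1)"
    "cochain_space K k" "weighted_inner K cl B D k" "cochain_space K w" "weighted_inner K cl B D w"
    "if k = 0 then \<lambda>\<phi> xs. 0 else dd_coboundary K d cl B (k - 1)"
    "if k = 0 then \<lambda>\<phi> xs. 0 else dd_codifferential K d cl D (k - 1)"
    "dd_coboundary K d cl B k" "dd_codifferential K d cl D k"
    unfolding w_def by (rule cochain_triple_dd[OF assms(6)])
  have L: "T.laplacian = hodge_laplacian K d cl B D k"
    by (intro ext) (simp add: T.laplacian_def hodge_laplacian_def)
  have im: "(if k = 0 then \<lambda>\<phi> xs. 0 else dd_coboundary K d cl B (k - 1)) ` cochains K (k - 1)
      = coboundary_image K d cl B k"
    using cochains_zero[of K "k - 1"] by (auto simp: coboundary_image_def)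
  show ?thesis
    using T.laplacian_positive_semidefinite T.dim_laplacian_kernel
    by (simp only: L im cochain_space_sel cohomology_def simp_thms)
qed

end
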